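(* Let $q>3$ and let $u\in W^{2,1}_q(Q_{T_1})$ be a solution of the hysteresis problem $$\partial_t u-\Delta u=\mathcal H(u)\ \text{ in } Q_{T_1},\qquad \partial_x u=0\ \text{ on } S_{T_1},\qquad u(x,0)=\varphi(x)\ \text{ in }\Omega,$$ whose initial function $\varphi\in W^{2-2/q}_q(\Omega)$ is topologically nontransverse at a point $x_0\in\Omega$ in the following sense: for some $\varepsilon>0$ the initial phase is I on $(x_0-\varepsilon,x_0)\cup(x_0,x_0+\varepsilon)$, $\varphi(x_0)=\beta$, and $\varphi(x)<\beta$ for $x\in(x_0-\varepsilon,x_0)\cup(x_0,x_0+\varepsilon)$. Let $0<\varepsilon_1<\varepsilon$ and $T_1>0$ be such that, with $\mathcal I=(x_0-\varepsilon_1,x_0+\varepsilon_1)$, one has $u(x,t)>\alpha$ for $x\in\mathcal I$, $t\in(0,T_1)$, and $u(x_0\pm\varepsilon_1,t)<\beta$ for $t\in(0,T_1)$. For $x\in\mathcal I$ put $r(x)=\inf\{t\in[0,T_1):u(x,t)\ge\beta\}$, with $r(x)=T_1$ if $u(x,t)<\beta$ for all $t\in[0,T_1)$. Suppose that $r(x)<T_1$ for all $x$ in some interval $(a,b)\subset\mathcal I$. Then: (i) if $r$ is continuous on $(a,b)$, then $r$ is constant on $(a,b)$; (ii) $\limsup_{x\to x_1-}r(x)=\limsup_{x\to x_1+}r(x)$ for every $x_1\in(a,b)$. Moreover, the function $\tilde r(x_1)=\limsup_{x\to x_1}r(x)$, $x_1\in(a,b)$, is constant on $(a,b)$, and $u(x_1,\tilde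 r(x_1))=\beta$ for $x_1\in(a,b)$.
   Context: $\Omega=(0,1)$, $Q_T=\Omega\times(0,T]$, $S_T=\partial\Omega\times(0,T]$, $\Delta=\partial_x^2$; $\alpha<0<\beta$ are fixed thresholds. $W^{2,1}_q(Q_T)$ is the parabolic Sobolev space with norm $\|\partial_t v\|_{q}+\|\Delta v\|_{q}+\|v\|_{q}$ (norms in $L^q(Q_T)$), and $W^{2-2/q}_q(\Omega)$ is its trace space at $t=0$; for $q>3$ elements of $W^{2,1}_q(Q_T)$ are, together with $\partial_x v$, continuous on $\overline Q_T$, and $W^{2-2/q}_q(\Omega)\subset C^1(\overline\Omega)$. The initial function satisfies $\partial_x\varphi(0)=\partial_x\varphi(1)=0$. Initial phase distribution: a function $p:\Omega\to\{1,-1\}$, with $p(x)=1$ meaning phase I and $p(x)=-1$ meaning phase II at $x$, such that $p(x)=1$ whenever $\varphi(x)\le\alpha$ and $p(x)=-1$ whenever $\varphi(x)\ge\beta$; where $\alpha<\varphi(x)<\beta$ the phase may be prescribed arbitrarily. Hysteresis operator: for $u$ continuous on $\overline Q_T$ with $u(\cdot,0)=\varphi$, put $\mathcal H(u(x,0))=p(x)$; $\mathcal H(u(x,t))=1$ if $u(x,t)\le\alpha$; $\mathcal H(u(x,t))=-1$ if $u(x,t)\ge\beta$. Let $E=\{(x,t)\in Q_T:u\le\alpha\}\cup\{(x,t)\in Q_T:u\ge\beta\}\cup(\Omega\times\{0\})$. If $(x,t)\notin E$, put $\mathcal H(u(x,t))=\mathcal H(u(x,\tau(x)))$ with $\tau(x)=\max\{s\le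 t:(x,s)\in E\}$. The equation is understood almost everywhere. Limits superior as $x\to x_1$ are over $x\ne x_1$. *)

theory Defs
  imports "HOL-Analysis.Analysis"
begin

text \<open>Points of the space-time plane are pairs \<open>(x, t)\<close>.\<close>

definition Omega :: "real set"
  where "Omega = {0<..<1}"

definition Q :: "real \<Rightarrow> (real \<times> real) set"
  where "Q T = Omega \<times> {0<..T}"

definition S :: "real \<Rightarrow> (real \<times> real) set"
  where "S T = {0, 1} \<times> {0<..T}"


subsection \<open>Parabolic Sobolev spaces\<close>

definition pd_x :: "(real \<times> real \<Rightarrow> real) \<Rightarrow> real \<times> real \<Rightarrow> real"
  where "pd_x f = (\<lambda>(x, t). deriv (\<lambda>y. f (y, t)) x)"

definition pd_t :: "(real \<times> real \<Rightarrow> real) \<Rightarrow> real \<times> real \<Rightarrow> real"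
  where "pd_t f = (\<lambda>(x, t). deriv (\<lambda>s. f (x, s)) t)"

text \<open>Class \<open>C\<^sup>\<infinity>\<close> on the plane: \<open>D i j\<close> is the partial derivative of order \<open>i\<close> in \<open>x\<close> and \<open>j\<close> in \<open>t\<close>;
  all of these exist and are jointly continuous.\<close>

definition smooth :: "(real \<times> real \<Rightarrow> real) \<Rightarrow> bool"
  where "smooth f \<longleftrightarrow> (\<exists>D :: nat \<Rightarrow> nat \<Rightarrow> real \<times> real \<Rightarrow> real. D 0 0 = f \<and>
    (\<forall>i j. continuous_on UNIV (D i j) \<and>
      (\<forall>x t. ((\<lambda>y. D i j (y, t)) has_real_derivative D (Suc i) j (x, t)) (at x) \<and>
             ((\<lambda>s. D i j (x, s)) has_real_derivative D i (Suc j) (x, t)) (at t))))"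

definition test_functions :: "(real \<times> real) set \<Rightarrow> (real \<times> real \<Rightarrow> real) set"
  where "test_functions U =
    {\<psi>. smooth \<psi> \<and> (\<exists>K. compact K \<and> K \<subseteq> U \<and> (\<forall>z. z \<notin> K \<longrightarrow> \<psi> z = 0))}"

definition Lq :: "real \<Rightarrow> (real \<times> real) set \<Rightarrow> (real \<times> real \<Rightarrow> real) set"
  where "Lq q U = {f. f \<in> borel_measurable (lebesgue_on U) \<and>
    integrable (lebesgue_on U) (\<lambda>z. \<bar>f z\<bar> powr q)}"

definition has_weak_dt :: "(real \<times> real \<Rightarrow> real) \<Rightarrow> (real \<times> real \<Rightarrow> real) \<Rightarrow> (real \<times> real) set \<Rightarrow> bool"
  where "has_weak_dt v g U \<longleftrightarrow> (\<forall>\<psi>\<in>test_functions U.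
    (LINT z|lebesgue_on U. v z * pd_t \<psi> z) = - (LINT z|lebesgue_on U. g z * \<psi> z))"

definition has_weak_Laplacian :: "(real \<times> real \<Rightarrow> real) \<Rightarrow> (real \<times> real \<Rightarrow> real) \<Rightarrow> (real \<times> real) set \<Rightarrow> bool"
  where "has_weak_Laplacian v h U \<longleftrightarrow> (\<forall>\<psi>\<in>test_functions U.
    (LINT z|lebesgue_on U. v z * pd_x (pd_x \<psi>) z) = (LINT z|lebesgue_on U. h z * \<psi> z))"

text \<open>Finiteness of the norm \<open>\<parallel>\<partial>\<^sub>t v\<parallel> + \<parallel>\<Delta> v\<parallel> + \<parallel>v\<parallel>\<close> in \<open>L\<^sup>q\<close>. In one space dimension this forces
  \<open>\<partial>\<^sub>x v \<in> L\<^sup>q\<close>. Test functions live on the interior of \<open>Q T\<close>.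

  For \<open>q > 3\<close> every element has a unique representative that is continuous on the closure of \<open>Q T\<close>;
  elements are identified with it, so that pointwise values make sense.\<close>

definition W21 :: "real \<Rightarrow> real \<Rightarrow> (real \<times> real \<Rightarrow> real) set"
  where "W21 q T = {v. continuous_on (closure (Q T)) v \<and> v \<in> Lq q (interior (Q T)) \<and>
    (\<exists>g\<in>Lq q (interior (Q T)). has_weak_dt v g (interior (Q T))) \<and>
    (\<exists>h\<in>Lq q (interior (Q T)). has_weak_Laplacian v h (interior (Q T)))}"

text \<open>The space \<open>W\<close> of order \<open>2 - 2/q\<close>, i.e.\ the traces at \<open>t = 0\<close>. It does not depend on \<open>T\<close>, by
  rescaling time. Elements are functions on the closure of \<open>Omega\<close>.\<close>

definition W_trace :: "real \<Rightarrow> (real \<Rightarrow> real) set"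
  where "W_trace q = {\<phi>. \<exists>T>0. \<exists>v\<in>W21 q T. \<forall>x\<in>closure Omega. \<phi> x = v (x, 0)}"


subsection \<open>Hysteresis\<close>

text \<open>Phases I and II are the values \<open>1\<close> and \<open>-1\<close>.\<close>

definition initial_phase :: "real \<Rightarrow> real \<Rightarrow> (real \<Rightarrow> real) \<Rightarrow> (real \<Rightarrow> real) \<Rightarrow> bool"
  where "initial_phase \<alpha> \<beta> \<phi> p \<longleftrightarrow> (\<forall>x\<in>Omega. p x \<in> {1, -1} \<and>
    (\<phi> x \<le> \<alpha> \<longrightarrow> p x = 1) \<and> (\<phi> x \<ge> \<beta> \<longrightarrow> p x = -1))"

definition hyst_E :: "real \<Rightarrow> real \<Rightarrow> real \<Rightarrow> (real \<times> real \<Rightarrow> real) \<Rightarrow> (real \<times> real) set"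
  where "hyst_E \<alpha> \<beta> T u = {z \<in> Q T. u z \<le> \<alpha>} \<union> {z \<in> Q T. u z \<ge> \<beta>} \<union> Omega \<times> {0}"

definition hyst_on_E :: "real \<Rightarrow> (real \<Rightarrow> real) \<Rightarrow> (real \<times> real \<Rightarrow> real) \<Rightarrow> real \<times> real \<Rightarrow> real"
  where "hyst_on_E \<alpha> p u = (\<lambda>(x, t). if t = 0 then p x else if u (x, t) \<le> \<alpha> then 1 else -1)"

definition hyst_tau :: "real \<Rightarrow> real \<Rightarrow> real \<Rightarrow> (real \<times> real \<Rightarrow> real) \<Rightarrow> real \<times> real \<Rightarrow> real"
  where "hyst_tau \<alpha> \<beta> T u = (\<lambda>(x, t). GREATEST s. s \<le> t \<and> (x, s) \<in> hyst_E \<alpha> \<beta> T u)"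

definition hyst :: "real \<Rightarrow> real \<Rightarrow> real \<Rightarrow> (real \<Rightarrow> real) \<Rightarrow> (real \<times> real \<Rightarrow> real) \<Rightarrow> real \<times> real \<Rightarrow> real"
  where "hyst \<alpha> \<beta> T p u = (\<lambda>(x, t).
    if (x, t) \<in> hyst_E \<alpha> \<beta> T u then hyst_on_E \<alpha> p u (x, t)
    else hyst_on_E \<alpha> p u (x, hyst_tau \<alpha> \<beta> T u (x, t)))"

text \<open>Since \<open>\<partial>\<^sub>x u\<close> is continuous up to the boundary when \<open>q > 3\<close>, its boundary values are the one-sided
  classical derivatives.\<close>

definition hysteresis_solution ::
    "real \<Rightarrow> real \<Rightarrow> real \<Rightarrow> real \<Rightarrow> (real \<Rightarrow> real) \<Rightarrow> (real \<Rightarrow> real) \<Rightarrow> (real \<times> real \<Rightarrow> real) \<Rightarrow> bool"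
  where "hysteresis_solution q \<alpha> \<beta> T \<phi> p u \<longleftrightarrow>
    u \<in> W21 q T \<and>
    (\<exists>g\<in>Lq q (interior (Q T)). \<exists>h\<in>Lq q (interior (Q T)).
      has_weak_dt u g (interior (Q T)) \<and> has_weak_Laplacian u h (interior (Q T)) \<and>
      (AE z in lebesgue_on (Q T). g z - h z = hyst \<alpha> \<beta> T p u z)) \<and>
    (\<forall>(x, t)\<in>S T. ((\<lambda>y. u (y, t)) has_real_derivative 0) (at x within closure Omega)) \<and>
    (\<forall>x\<in>Omega. u (x, 0) = \<phi> x)"


subsection \<open>Nontransversality and switching times\<close>

definition top_nontransverse_at ::
    "real \<Rightarrow> (real \<Rightarrow> real) \<Rightarrow> (real \<Rightarrow> real) \<Rightarrow> real \<Rightarrow> real \<Rightarrow> bool"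
  where "top_nontransverse_at \<beta> \<phi> p x0 \<epsilon> \<longleftrightarrow>
    \<epsilon> > 0 \<and> {x0 - \<epsilon><..<x0 + \<epsilon>} \<subseteq> Omega \<and> \<phi> x0 = \<beta> \<and>
    (\<forall>x\<in>{x0 - \<epsilon><..<x0} \<union> {x0<..<x0 + \<epsilon>}. p x = 1 \<and> \<phi> x < \<beta>)"

definition switch_time :: "real \<Rightarrow> real \<Rightarrow> (real \<times> real \<Rightarrow> real) \<Rightarrow> real \<Rightarrow> real"
  where "switch_time \<beta> T u x =
    (if \<forall>t\<in>{0..<T}. u (x, t) < \<beta> then T else Inf {t \<in> {0..<T}. u (x, t) \<ge> \<beta>})"

text \<open>Limits superior are taken in the extended reals; for \<open>f\<close> bounded near \<open>x\<close>, as switching times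
  are, the value is finite and the conversion back to \<open>real\<close> loses nothing.\<close>

definition limsup_fun :: "(real \<Rightarrow> real) \<Rightarrow> real \<Rightarrow> real"
  where "limsup_fun f x = real_of_ereal (Limsup (at x) (\<lambda>y. ereal (f y)))"

end

theory Submission
  imports Defs
begin

text \<open>The proof rests on two consequences of the topological nontransversality. Let \<open>r\<close> be the switching time.

  The first is \<open>u \<le> \<beta>\<close> on the whole strip: on the parabolic boundary the hypotheses give it, and where \<open>u > \<beta>\<close> the phase has
  switched, \<open>u\<close> is a strict subsolution of the heat equation, and the maximum principle applies (\<open>u_le\<close>).

  The second is that the switched region never reaches a point with \<open>u = \<beta>\<close> obliquely. By the first step such
  a point is a spatial maximum of \<open>u\<close>. In a switched wedge with vertex at this point, \<open>\<beta> - u\<close> is a nonnegative strict supersolution and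
  by Hopf's argument leaves its zero with positive slope, while \<open>\<partial>\<^sub>x u\<close> should vanish there. Differentiability
  of \<open>u\<close> is not used: the kink is contradicted directly by a test function with large curvature (\<open>no_oblique_touching\<close>).

  Every point \<open>(x, t)\<close> in the closure of the graph of \<open>r\<close> satisfies \<open>u (x, t) = \<beta>\<close>, and the points above the graph are switched. So
  no smooth function with nonzero slope touches the graph from above; hence the upper envelope of \<open>r\<close> is constant
  (\<open>graph_closure_constant\<close>). All claims follow: a continuous \<open>r\<close> equals its envelope, and one-sided limits superior
  of \<open>r\<close> only see the envelope.

  The equation enters only through one lemma (\<open>heat_subsol_touching\<close>): a continuous function with
  \<open>\<partial>\<^sub>t u - \<partial>\<^sub>x\<^sup>2 u \<le> k\<close> in the sense of distributions is a viscosity subsolution. Its proof mollifies \<open>u\<close> with a kernel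
  supported strictly in the past, so that the final time of the cylinder is included.\<close>


section \<open>Smooth bump functions\<close>

text \<open>Multiplying by a polynomial in \<open>1 / x\<close> makes the family of flat functions \<open>exp (- 1 / x)\<close> closed under differentiation,
  so that one computation settles all orders at once.\<close>

definition flat :: "real poly \<Rightarrow> real \<Rightarrow> real"
  where "flat p x = (if x \<le> 0 then 0 else poly p (1 / x) * exp (- (1 / x)))"

lemma poly_times_exp_minus_tendsto_0: "((\<lambda>y::real. poly p y * exp (- y)) \<longlongrightarrow> 0) at_top"
proof -
  have "((\<lambda>y::real. \<Sum>i\<le>degree p. coeff p i * (y ^ i / exp y)) \<longlongrightarrow> (\<Sum>i\<le>degree p. coeff p i * 0)) at_top"
    by (intro tendsto_sum tendsto_mult tendsto_const tendsto_power_div_exp_0)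
  moreover have "(\<lambda>y::real. poly p y * exp (- y)) = (\<lambda>y. \<Sum>i\<le>degree p. coeff p i * (y ^ i / exp y))"
    by (simp add: poly_altdef sum_distrib_right exp_minus divide_inverse mult.assoc)
  ultimately show ?thesis by simp
qed

lemma flat_tendsto_0: "(flat p \<longlongrightarrow> 0) (at 0)"
proof -
  have "((\<lambda>x. poly p (inverse x) * exp (- inverse x)) \<longlongrightarrow> 0) (at_right 0)"
    by (rule filterlim_compose[OF poly_times_exp_minus_tendsto_0 filterlim_inverse_at_top_right])
  then have "(flat p \<longlongrightarrow> 0) (at_right 0)"
    by (rule Lim_transform_eventually)
       (auto simp: eventually_at_right_field flat_def inverse_eq_divide intro: exI[of _ 1])
  moreover have "(flat p \<longlongrightarrow> 0) (at_left 0)"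
    by (rule Lim_transform_eventually[OF tendsto_const])
       (auto simp: eventually_at_left_field flat_def intro: exI[of _ "-1"])
  ultimately show ?thesis by (simp add: filterlim_split_at)
qed

text \<open>At \<open>0\<close> the difference quotient of \<open>flat p\<close> is itself a flat function, that of \<open>pCons 0 p\<close>, and tends to \<open>0\<close>.\<close>

lemma flat_has_derivative:
  "(flat p has_real_derivative flat ([:0, 0, 1:] * (p - pderiv p)) x) (at x)"
proof -
  consider "x < 0" | "x = 0" | "x > 0" by linarith
  then show ?thesis
  proof cases
    case 1
    have "((\<lambda>_. 0) has_real_derivative 0) (at x)" by simp
    then have "(flat p has_real_derivative 0) (at x)"
      by (rule has_field_derivative_transform_within_open[of _ _ _ "{..<0}"])
         (use 1 in \<open>auto simp: flat_def\<close>)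
    then show ?thesis using 1 by (simp add: flat_def)
  next
    case 2
    have "((\<lambda>h. (flat p (0 + h) - flat p 0) / h) \<longlongrightarrow> 0) (at 0)"
      by (rule Lim_transform_eventually[OF flat_tendsto_0[of "pCons 0 p"]])
         (auto simp: flat_def eventually_at_filter)
    then show ?thesis using 2 by (simp add: DERIV_def flat_def)
  next
    case 3
    have "((\<lambda>x. poly p (1 / x) * exp (- (1 / x))) has_real_derivative
        flat ([:0, 0, 1:] * (p - pderiv p)) x) (at x)"
      using 3 by (auto intro!: derivative_eq_intros DERIV_chain2[OF poly_DERIV]
          simp: flat_def field_simps power2_eq_square)
    then show ?thesis
      by (rule has_field_derivative_transform_within_open[of _ _ _ "{0<..}"])
         (use 3 in \<open>auto simp: flat_def\<close>)
  qed
qed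

text \<open>The bump will be \<open>flat 1 (s - l) * flat 1 (r - s)\<close>. Its derivatives are given no formula:
  it lies in a class of functions which vanish outside \<open>{l<..<r}\<close> and which contains a derivative of each
  of its members. Differences suffice as closure operation, because the inner derivative of \<open>r - s\<close> is \<open>- 1\<close>.\<close>

inductive_set bump_like :: "real \<Rightarrow> real \<Rightarrow> (real \<Rightarrow> real) set" for l r where
  prod: "(\<lambda>s. flat p (s - l) * flat q (r - s)) \<in> bump_like l r"
| diff: "f \<in> bump_like l r \<Longrightarrow> g \<in> bump_like l r \<Longrightarrow> (\<lambda>s. f s - g s) \<in> bump_like l r"

lemma bump_like_has_derivative:
  assumes "f \<in> bump_like l r"
  shows "\<exists>g\<in>bump_like l r. \<forall>s. (f has_real_derivative g s) (at s)"
  using assms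
proof induction
  case (prod p q)
  let ?d = "\<lambda>p. [:0, 0, 1:] * (p - pderiv p)"
  have 1: "((\<lambda>s. flat p (s - l) * flat q (r - s)) has_real_derivative
      flat (?d p) (s - l) * flat q (r - s) - flat p (s - l) * flat (?d q) (r - s)) (at s)" for s
    by (auto intro!: derivative_eq_intros DERIV_chain2[OF flat_has_derivative] simp: algebra_simps)
  show ?case
    by (intro bexI[of _ "\<lambda>s. flat (?d p) (s - l) * flat q (r - s) - flat p (s - l) * flat (?d q) (r - s)"])
       (use 1 in blast, intro bump_like.intros)
next
  case (diff f g)
  then obtain f' g' where "f' \<in> bump_like l r" "g' \<in> bump_like l r"
    "\<forall>s. (f has_real_derivative f' s) (at s)" "\<forall>s. (g has_real_derivative g' s) (at s)"
    by blast
  then show ?case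
    by (intro bexI[of _ "\<lambda>s. f' s - g' s"]) (auto intro: DERIV_diff bump_like.diff)
qed

lemma bump_like_eq_0:
  assumes "f \<in> bump_like l r" "s \<notin> {l<..<r}"
  shows "f s = 0"
  using assms by induction (auto simp: flat_def)

lemma exists_bump:
  fixes l r :: real
  assumes "l < r"
  obtains D :: "nat \<Rightarrow> real \<Rightarrow> real" where
    "\<And>n s. (D n has_real_derivative D (Suc n) s) (at s)"
    "\<And>n s. s \<notin> {l<..<r} \<Longrightarrow> D n s = 0"
    "\<And>s. D 0 s \<ge> 0" "\<And>s. s \<in> {l<..<r} \<Longrightarrow> D 0 s > 0"
proof -
  define f where "f = (\<lambda>s. flat 1 (s - l) * flat 1 (r - s))"
  have "\<exists>D. D 0 = f \<and> (\<forall>n. D n \<in> bump_like l r \<and> (\<forall>s. (D n has_real_derivative D (Suc n) s) (at s)))"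
  proof -
    have "\<exists>D. \<forall>n. (D n \<in> bump_like l r \<and> (n = 0 \<longrightarrow> D n = f)) \<and>
        (\<forall>s. (D n has_real_derivative D (Suc n) s) (at s))"
    proof (rule dependent_nat_choice)
      show "\<exists>x. x \<in> bump_like l r \<and> (0 = 0 \<longrightarrow> x = f)"
        unfolding f_def using bump_like.prod by blast
    qed (use bump_like_has_derivative in blast)
    then show ?thesis by blast
  qed
  then obtain D where D: "D 0 = f" "\<And>n. D n \<in> bump_like l r"
    "\<And>n s. (D n has_real_derivative D (Suc n) s) (at s)" by blast
  show thesis
  proof (rule that[of D])
    show "D n s = 0" if "s \<notin> {l<..<r}" for n s
      using bump_like_eq_0[OF D(2) that] .
  qed (use D in \<open>auto simp: f_def flat_def\<close>)
qed

section \<open>Mollification of weak subsolutions\<close>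

text \<open>This is \<open>\<partial>\<^sub>t u - \<partial>\<^sub>x\<^sup>2 u \<le> k\<close> in the sense of distributions, integrated by parts against nonnegative
  test functions; only \<open>u\<close> itself occurs, no derivative of it.\<close>

definition heat_subsol :: "(real \<times> real \<Rightarrow> real) \<Rightarrow> real \<Rightarrow> (real \<times> real) set \<Rightarrow> bool"
  where "heat_subsol u k V \<longleftrightarrow> (\<forall>\<psi>\<in>test_functions V. (\<forall>z. \<psi> z \<ge> 0) \<longrightarrow>
    - k * (LINT z|lebesgue_on V. \<psi> z) \<le> (LINT z|lebesgue_on V. u z * (pd_t \<psi> z + pd_x (pd_x \<psi>) z)))"

lemma box_Pair_iff:
  "z \<in> box (a, c) (b, d) \<longleftrightarrow> a < fst z \<and> fst z < b \<and> c < snd z \<and> snd z < (d::real)" for a :: real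
  by (cases z) (auto simp: box_def Basis_prod_def)

lemma cbox_Pair_iff:
  "z \<in> cbox (a, c) (b, d) \<longleftrightarrow> a \<le> fst z \<and> fst z \<le> b \<and> c \<le> snd z \<and> snd z \<le> (d::real)" for a :: real
  by (cases z) auto

lemma integral_lebesgue_on_box:
  fixes f :: "real \<times> real \<Rightarrow> real"
  assumes "continuous_on (cbox a b) f"
  shows "(LINT z|lebesgue_on (box a b). f z) = integral (cbox a b) f"
proof -
  have "integrable (lebesgue_on (box a b)) f"
  proof -
    have "set_integrable lebesgue (box a b) f"
      by (rule set_integrable_subset[OF absolutely_integrable_continuous[OF assms]])
         (auto simp: box_subset_cbox)
    then show ?thesis
      by (simp add: integrable_restrict_space set_integrable_def)
  qed
  then show ?thesis
    by (simp add: lebesgue_integral_eq_integral integral_open_interval)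
qed

text \<open>The argument \<open>\<zeta>\<close> is the integration variable. A bump supported in \<open>{l<..<r}\<close> with \<open>0 < l\<close>
  makes \<open>kernel D n m z\<close> live strictly before the time of \<open>z\<close>: mollified functions are then smooth, and
  satisfy the differential inequality, up to and including the final time. That the support is also shifted in \<open>x\<close> is
  harmless, and lets one bump serve both variables.\<close>

definition kernel :: "(nat \<Rightarrow> real \<Rightarrow> real) \<Rightarrow> nat \<Rightarrow> nat \<Rightarrow> real \<times> real \<Rightarrow> real \<times> real \<Rightarrow> real"
  where "kernel D n m z \<zeta> = D n (fst z - fst \<zeta>) * D m (snd z - snd \<zeta>)"

locale smooth_bump =
  fixes D :: "nat \<Rightarrow> real \<Rightarrow> real" and l r :: real
  assumes l_less_r: "l < r"
    and bump_deriv: "\<And>n s. (D n has_real_derivative D (Suc n) s) (at s)"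
    and bump_eq_0: "\<And>n s. s \<notin> {l<..<r} \<Longrightarrow> D n s = 0"
    and bump_nonneg: "\<And>s. D 0 s \<ge> 0"
    and bump_pos: "\<And>s. s \<in> {l<..<r} \<Longrightarrow> D 0 s > 0"
begin

lemma continuous_on_bump [continuous_intros]:
  "continuous_on A f \<Longrightarrow> continuous_on A (\<lambda>x. D n (f x))"
  by (rule continuous_on_compose2[of UNIV "D n"])
     (auto intro: DERIV_continuous_on has_field_derivative_at_within bump_deriv)

lemma continuous_on_kernel [continuous_intros]:
  "continuous_on A f \<Longrightarrow> continuous_on A g \<Longrightarrow> continuous_on A (\<lambda>x. kernel D n m (f x) (g x))"
  unfolding kernel_def by (intro continuous_intros)

lemma kernel_nonneg: "kernel D 0 0 z \<zeta> \<ge> 0"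
  by (simp add: kernel_def bump_nonneg)

lemma kernel_eq_0:
  assumes "\<zeta> \<notin> box (fst z - r, snd z - r) (fst z - l, snd z - l)"
  shows "kernel D n m z \<zeta> = 0"
proof -
  have "fst z - fst \<zeta> \<notin> {l<..<r} \<or> snd z - snd \<zeta> \<notin> {l<..<r}"
    using assms by (auto simp: box_Pair_iff)
  then show ?thesis using bump_eq_0 by (auto simp: kernel_def)
qed

lemma kernel_deriv:
  "((\<lambda>y. kernel D n m (y, t) \<zeta>) has_real_derivative kernel D (Suc n) m (x, t) \<zeta>) (at x)"
  "((\<lambda>s. kernel D n m (x, s) \<zeta>) has_real_derivative kernel D n (Suc m) (x, t) \<zeta>) (at t)"
  unfolding kernel_def
  by (auto intro!: derivative_eq_intros DERIV_chain2[OF bump_deriv])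

lemma kernel_deriv_snd:
  "((\<lambda>y. kernel D n m z (y, t)) has_real_derivative - kernel D (Suc n) m z (x, t)) (at x)"
  "((\<lambda>s. kernel D n m z (x, s)) has_real_derivative - kernel D n (Suc m) z (x, t)) (at t)"
  unfolding kernel_def
  by (auto intro!: derivative_eq_intros DERIV_chain2[OF bump_deriv])

lemma kernel_test_function:
  assumes "cbox (fst z - r, snd z - r) (fst z - l, snd z - l) \<subseteq> V"
  shows "kernel D 0 0 z \<in> test_functions V"
proof -
  have "((\<lambda>y. (- 1) ^ (i + j) * kernel D i j z (y, t)) has_real_derivative
          (- 1) ^ (Suc i + j) * kernel D (Suc i) j z (x, t)) (at x)"
       "((\<lambda>s. (- 1) ^ (i + j) * kernel D i j z (x, s)) has_real_derivative
          (- 1) ^ (i + Suc j) * kernel D i (Suc j) z (x, t)) (at t)" for i j x t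
    by (auto intro!: derivative_eq_intros kernel_deriv_snd)
  then have "smooth (kernel D 0 0 z)"
    unfolding smooth_def
    by (intro exI[of _ "\<lambda>i j \<zeta>. (- 1) ^ (i + j) * kernel D i j z \<zeta>"]) 
       (auto intro!: continuous_intros)
  moreover have "\<forall>\<zeta>. \<zeta> \<notin> cbox (fst z - r, snd z - r) (fst z - l, snd z - l) \<longrightarrow> kernel D 0 0 z \<zeta> = 0"
    using box_subset_cbox kernel_eq_0 by blast
  ultimately show ?thesis
    unfolding test_functions_def using assms compact_cbox by blast
qed

lemma pd_kernel:
  "pd_t (kernel D n m z) \<zeta> = - kernel D n (Suc m) z \<zeta>"
  "pd_x (pd_x (kernel D n m z)) \<zeta> = kernel D (Suc (Suc n)) m z \<zeta>"
proof -
  have *: "pd_x (kernel D n m z) = (\<lambda>\<zeta>. - kernel D (Suc n) m z \<zeta>)" for n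
    by (auto simp: pd_x_def fun_eq_iff intro!: DERIV_imp_deriv kernel_deriv_snd)
  show "pd_t (kernel D n m z) \<zeta> = - kernel D n (Suc m) z \<zeta>"
    by (cases \<zeta>) (auto simp: pd_t_def intro!: DERIV_imp_deriv kernel_deriv_snd)
  have "((\<lambda>y. - kernel D (Suc n) m z (y, t)) has_real_derivative kernel D (Suc (Suc n)) m z (x, t)) (at x)" for x t
    by (auto intro!: derivative_eq_intros kernel_deriv_snd)
  then show "pd_x (pd_x (kernel D n m z)) \<zeta> = kernel D (Suc (Suc n)) m z \<zeta>"
    unfolding * by (cases \<zeta>) (auto simp: pd_x_def intro!: DERIV_imp_deriv)
qed

definition mass :: real
  where "mass = integral (cbox (l, l) (r, r)) (\<lambda>\<zeta>. D 0 (fst \<zeta>) * D 0 (snd \<zeta>))"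

lemma mass_pos: "mass > 0"
proof -
  let ?f = "\<lambda>\<zeta>::real \<times> real. D 0 (fst \<zeta>) * D 0 (snd \<zeta>)"
  define c where "c = (l + r) / 2"
  have c: "c \<in> {l<..<r}" using l_less_r by (simp add: c_def)
  then have c': "(c, c) \<in> box (l, l) (r, r)" by (simp add: box_Pair_iff)
  have "continuous_on (cbox (l, l) (r, r)) ?f" by (intro continuous_intros)
  moreover have "box (l, l) (r, r) \<noteq> {}" using c' by blast
  moreover have "?f (c, c) > 0" using bump_pos[OF c] by simp
  ultimately have "mass \<noteq> 0"
    unfolding mass_def using c' box_subset_cbox[of "(l, l)" "(r, r)"]
    by (subst integral_cbox_eq_0_iff) (auto simp: bump_nonneg intro!: bexI[of _ "(c, c)"])
  moreover have "mass \<ge> 0"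
    unfolding mass_def by (rule integral_nonneg) (auto simp: bump_nonneg intro!: integrable_continuous continuous_intros)
  ultimately show ?thesis by simp
qed

text \<open>Translation invariance: the total mass must not depend on \<open>z\<close>, since dividing by it has to commute
  with differentiation in \<open>z\<close>.\<close>

lemma integral_kernel:
  assumes "cbox (fst z - r, snd z - r) (fst z - l, snd z - l) \<subseteq> K"
  shows "(kernel D 0 0 z has_integral mass) K"
proof -
  let ?f = "\<lambda>\<zeta>::real \<times> real. D 0 (fst \<zeta>) * D 0 (snd \<zeta>)"
  have "(?f has_integral mass) (cbox (l, l) (r, r))"
    unfolding mass_def by (intro integrable_integral integrable_continuous continuous_intros)
  from has_integral_affinity[OF this, of "-1" z]
  have "((\<lambda>\<zeta>. ?f (z - \<zeta>)) has_integral mass) ((\<lambda>x. z - x) ` cbox (l, l) (r, r))"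
    by simp
  also have "(\<lambda>x. z - x) ` cbox (l, l) (r, r) = cbox (z - (r, r)) (z - (l, l))"
  proof (intro equalityI subsetI)
    fix y assume "y \<in> cbox (z - (r, r)) (z - (l, l))"
    then have "z - y \<in> cbox (l, l) (r, r)" by (cases z; cases y) auto
    then show "y \<in> (\<lambda>x. z - x) ` cbox (l, l) (r, r)" by (intro image_eqI[of _ _ "z - y"]) auto
  qed (cases z, auto)
  also have "\<dots> = cbox (fst z - r, snd z - r) (fst z - l, snd z - l)"
    by (cases z) simp
  finally have "(kernel D 0 0 z has_integral mass) (cbox (fst z - r, snd z - r) (fst z - l, snd z - l))"
    by (simp add: kernel_def[abs_def])
  then show ?thesis
    by (rule has_integral_on_superset) (use assms kernel_eq_0 box_subset_cbox in blast)+
qed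

definition convolve :: "(real \<times> real \<Rightarrow> real) \<Rightarrow> (real \<times> real) set \<Rightarrow> nat \<Rightarrow> nat \<Rightarrow> real \<times> real \<Rightarrow> real"
  where "convolve u K n m z = integral K (\<lambda>\<zeta>. u \<zeta> * kernel D n m z \<zeta>) / mass"

lemma convolve_deriv:
  assumes "continuous_on (cbox a b) u"
  shows "((\<lambda>y. convolve u (cbox a b) n m (y, t)) has_real_derivative convolve u (cbox a b) (Suc n) m (x, t)) (at x)"
    and "((\<lambda>s. convolve u (cbox a b) n m (x, s)) has_real_derivative convolve u (cbox a b) n (Suc m) (x, t)) (at t)"
proof -
  have u: "continuous_on (UNIV \<times> cbox a b) (\<lambda>p. u (snd p))"
    by (rule continuous_on_compose2[OF assms]) (auto intro!: continuous_intros)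
  have 1: "continuous_on (UNIV \<times> cbox a b) (\<lambda>(y, \<zeta>). u \<zeta> * kernel D (Suc n) m (y, t) \<zeta>)"
    unfolding case_prod_unfold by (intro continuous_intros u)
  have 2: "continuous_on (UNIV \<times> cbox a b) (\<lambda>(s, \<zeta>). u \<zeta> * kernel D n (Suc m) (x, s) \<zeta>)"
    unfolding case_prod_unfold by (intro continuous_intros u)
  have "((\<lambda>y. integral (cbox a b) (\<lambda>\<zeta>. u \<zeta> * kernel D n m (y, t) \<zeta>)) has_real_derivative
      integral (cbox a b) (\<lambda>\<zeta>. u \<zeta> * kernel D (Suc n) m (x, t) \<zeta>)) (at x within UNIV)"
    by (rule leibniz_rule_field_derivative[OF _ _ 1])
       (auto intro!: DERIV_cmult kernel_deriv integrable_continuous continuous_intros assms)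
  moreover have "((\<lambda>s. integral (cbox a b) (\<lambda>\<zeta>. u \<zeta> * kernel D n m (x, s) \<zeta>)) has_real_derivative
      integral (cbox a b) (\<lambda>\<zeta>. u \<zeta> * kernel D n (Suc m) (x, t) \<zeta>)) (at t within UNIV)"
    by (rule leibniz_rule_field_derivative[OF _ _ 2])
       (auto intro!: DERIV_cmult kernel_deriv integrable_continuous continuous_intros assms)
  ultimately show "((\<lambda>y. convolve u (cbox a b) n m (y, t)) has_real_derivative convolve u (cbox a b) (Suc n) m (x, t)) (at x)"
    and "((\<lambda>s. convolve u (cbox a b) n m (x, s)) has_real_derivative convolve u (cbox a b) n (Suc m) (x, t)) (at t)"
    unfolding convolve_def by (auto intro: DERIV_cdivide)
qed

lemma continuous_on_convolve:
  assumes "continuous_on (cbox a b) u"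
  shows "continuous_on UNIV (convolve u (cbox a b) n m)"
proof -
  have "continuous_on (UNIV \<times> cbox a b) (\<lambda>p. u (snd p))"
    by (rule continuous_on_compose2[OF assms]) (auto intro!: continuous_intros)
  then have "continuous_on (UNIV \<times> cbox a b) (\<lambda>(z, \<zeta>). u \<zeta> * kernel D n m z \<zeta>)"
    unfolding case_prod_unfold by (intro continuous_intros)
  from integral_continuous_on_param[OF this] show ?thesis
    unfolding convolve_def[abs_def] using mass_pos by (auto intro!: continuous_intros)
qed

text \<open>The kernel centred at \<open>z\<close> is an admissible test function, and each derivative that moves from \<open>\<zeta>\<close> to \<open>z\<close>
  changes the sign; this turns the weak inequality into the pointwise one.\<close>

lemma convolve_subsol:
  assumes u: "continuous_on (cbox a b) u"
    and sub: "heat_subsol u k (box a b)"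
    and z: "cbox (fst z - r, snd z - r) (fst z - l, snd z - l) \<subseteq> box a b"
  shows "convolve u (cbox a b) 0 1 z - convolve u (cbox a b) 2 0 z \<le> k"
proof -
  let ?I = "\<lambda>n m. integral (cbox a b) (\<lambda>\<zeta>. u \<zeta> * kernel D n m z \<zeta>)"
  have "- k * (LINT \<zeta>|lebesgue_on (box a b). kernel D 0 0 z \<zeta>)
      \<le> (LINT \<zeta>|lebesgue_on (box a b). u \<zeta> * (- kernel D 0 1 z \<zeta> + kernel D 2 0 z \<zeta>))"
    using bspec[OF sub[unfolded heat_subsol_def] kernel_test_function[OF z]] kernel_nonneg
    by (simp add: pd_kernel numeral_2_eq_2)
  also have "\<dots> = integral (cbox a b) (\<lambda>\<zeta>. u \<zeta> * (- kernel D 0 1 z \<zeta> + kernel D 2 0 z \<zeta>))"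
    by (intro integral_lebesgue_on_box continuous_intros u)
  also have "\<dots> = integral (cbox a b) (\<lambda>\<zeta>. u \<zeta> * kernel D 2 0 z \<zeta> - u \<zeta> * kernel D 0 1 z \<zeta>)"
    by (simp add: algebra_simps)
  also have "\<dots> = ?I 2 0 - ?I 0 1"
    by (intro Henstock_Kurzweil_Integration.integral_diff integrable_continuous continuous_intros u)
  also have "(LINT \<zeta>|lebesgue_on (box a b). kernel D 0 0 z \<zeta>) = integral (cbox a b) (kernel D 0 0 z)"
    by (intro integral_lebesgue_on_box continuous_intros)
  also have "\<dots> = mass"
    using integral_kernel[of z "cbox a b"] z box_subset_cbox[of a b] by (intro integral_unique) blast
  finally have "?I 0 1 - ?I 2 0 \<le> k * mass" by simp
  then show ?thesis
    unfolding convolve_def using mass_pos by (simp add: field_simps)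
qed

lemma convolve_close:
  assumes u: "continuous_on (cbox a b) u"
    and z: "cbox (fst z - r, snd z - r) (fst z - l, snd z - l) \<subseteq> cbox a b"
    and close: "\<And>\<zeta>. \<zeta> \<in> box (fst z - r, snd z - r) (fst z - l, snd z - l) \<Longrightarrow> \<bar>u \<zeta> - u z\<bar> \<le> \<mu>"
  shows "\<bar>convolve u (cbox a b) 0 0 z - u z\<bar> \<le> \<mu>"
proof -
  let ?k = "kernel D 0 0 z"
  have k: "(?k has_integral mass) (cbox a b)" by (rule integral_kernel[OF z])
  have i: "(\<lambda>\<zeta>. u \<zeta> * ?k \<zeta>) integrable_on cbox a b"
    by (intro integrable_continuous continuous_intros u)
  have "((\<lambda>\<zeta>. u \<zeta> * ?k \<zeta> - u z * ?k \<zeta>) has_integral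
      integral (cbox a b) (\<lambda>\<zeta>. u \<zeta> * ?k \<zeta>) - u z * mass) (cbox a b)"
    by (intro has_integral_diff has_integral_mult_right k integrable_integral i)
  moreover have "((\<lambda>\<zeta>. \<mu> * ?k \<zeta>) has_integral \<mu> * mass) (cbox a b)"
    by (intro has_integral_mult_right k)
  moreover have "norm (u \<zeta> * ?k \<zeta> - u z * ?k \<zeta>) \<le> \<mu> * ?k \<zeta>" for \<zeta>
  proof (cases "\<zeta> \<in> box (fst z - r, snd z - r) (fst z - l, snd z - l)")
    case True
    have "norm (u \<zeta> * ?k \<zeta> - u z * ?k \<zeta>) = \<bar>u \<zeta> - u z\<bar> * ?k \<zeta>"
      using kernel_nonneg[of z \<zeta>] by (simp add: left_diff_distrib[symmetric] abs_mult)
    also have "\<dots> \<le> \<mu> * ?k \<zeta>" by (intro mult_right_mono close True kernel_nonneg)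
    finally show ?thesis .
  qed (simp add: kernel_eq_0)
  ultimately have "norm (integral (cbox a b) (\<lambda>\<zeta>. u \<zeta> * ?k \<zeta>) - u z * mass) \<le> \<mu> * mass"
    by (metis (no_types, lifting) has_integral_iff integral_norm_bound_integral)
  then have "\<bar>(integral (cbox a b) (\<lambda>\<zeta>. u \<zeta> * ?k \<zeta>) - u z * mass) / mass\<bar> \<le> \<mu>"
    using mass_pos by (simp add: field_simps)
  then show ?thesis
    unfolding convolve_def using mass_pos by (simp add: diff_divide_distrib)
qed

end

lemma mollify_subsol:
  fixes x1 x2 t1 t2 y1 y2 s1 s2 k \<mu> :: real
  assumes u: "continuous_on (cbox (x1, t1) (x2, t2)) u"
    and sub: "heat_subsol u k (box (x1, t1) (x2, t2))"
    and sub_box: "x1 < y1" "y2 \<le> x2" "t1 < s1" "s2 \<le> t2"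
    and "\<mu> > 0"
  obtains v vx vxx vt :: "real \<times> real \<Rightarrow> real" where
    "\<And>x t. ((\<lambda>y. v (y, t)) has_real_derivative vx (x, t)) (at x)"
    "\<And>x t. ((\<lambda>y. vx (y, t)) has_real_derivative vxx (x, t)) (at x)"
    "\<And>x t. ((\<lambda>s. v (x, s)) has_real_derivative vt (x, t)) (at t)"
    "\<And>z. z \<in> cbox (y1, s1) (y2, s2) \<Longrightarrow> vt z - vxx z \<le> k"
    "\<And>z. z \<in> cbox (y1, s1) (y2, s2) \<Longrightarrow> \<bar>v z - u z\<bar> \<le> \<mu>"
    "continuous_on UNIV v"
proof -
  let ?K = "cbox (x1, t1) (x2, t2)"
  have "uniformly_continuous_on ?K u"
    by (rule compact_uniformly_continuous[OF u compact_cbox])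
  then obtain \<delta> where \<delta>: "\<delta> > 0"
    "\<And>z \<zeta>. z \<in> ?K \<Longrightarrow> \<zeta> \<in> ?K \<Longrightarrow> dist \<zeta> z < \<delta> \<Longrightarrow> dist (u \<zeta>) (u z) < \<mu>"
    using \<open>\<mu> > 0\<close> unfolding uniformly_continuous_on_def by meson
  define r where "r = min (\<delta> / 2) (min ((y1 - x1) / 2) ((s1 - t1) / 2))"
  have r: "r > 0" "2 * r \<le> \<delta>" "2 * r \<le> y1 - x1" "2 * r \<le> s1 - t1"
    using \<delta> sub_box by (auto simp: r_def min_def)
  have "r / 2 < r" using r by simp
  then obtain D :: "nat \<Rightarrow> real \<Rightarrow> real" where D: "\<And>n s. (D n has_real_derivative D (Suc n) s) (at s)"
    "\<And>n s. s \<notin> {r/2<..<r} \<Longrightarrow> D n s = 0"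
    "\<And>s. D 0 s \<ge> 0" "\<And>s. s \<in> {r/2<..<r} \<Longrightarrow> D 0 s > 0"
    by (rule exists_bump) blast
  interpret smooth_bump D "r/2" r
    by unfold_locales (use D r in auto)
  have inside: "cbox (fst z - r, snd z - r) (fst z - r/2, snd z - r/2) \<subseteq> box (x1, t1) (x2, t2)"
    if "z \<in> cbox (y1, s1) (y2, s2)" for z
    using that sub_box r unfolding cbox_Pair_iff box_Pair_iff subset_iff by auto
  note deriv = convolve_deriv[OF u]
  show thesis
  proof (rule that[of "convolve u ?K 0 0" "convolve u ?K 1 0" "convolve u ?K 2 0" "convolve u ?K 0 1"])
    fix z assume z: "z \<in> cbox (y1, s1) (y2, s2)"
    show "convolve u ?K 0 1 z - convolve u ?K 2 0 z \<le> k"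
      by (rule convolve_subsol[OF u sub inside[OF z]])
    show "\<bar>convolve u ?K 0 0 z - u z\<bar> \<le> \<mu>"
    proof (rule convolve_close[OF u])
      show "cbox (fst z - r, snd z - r) (fst z - r/2, snd z - r/2) \<subseteq> ?K"
        using inside[OF z] box_subset_cbox by blast
      fix \<zeta> assume \<zeta>: "\<zeta> \<in> box (fst z - r, snd z - r) (fst z - r/2, snd z - r/2)"
      have "dist \<zeta> z \<le> \<bar>fst \<zeta> - fst z\<bar> + \<bar>snd \<zeta> - snd z\<bar>"
        by (simp add: dist_prod_def dist_real_def sqrt_sum_squares_le_sum_abs)
      also have "\<dots> < \<delta>" using \<zeta> r by (auto simp: box_Pair_iff)
      finally have "dist \<zeta> z < \<delta>" .
      moreover have "\<zeta> \<in> ?K" "z \<in> ?K"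
        using \<zeta> z sub_box r by (auto simp: box_Pair_iff cbox_Pair_iff)
      ultimately show "\<bar>u \<zeta> - u z\<bar> \<le> \<mu>"
        using \<delta>(2)[of z \<zeta>] by (simp add: dist_real_def)
    qed
  qed (use continuous_on_convolve[OF u] deriv[where n=0 and m=0] deriv[where n=1 and m=0] in \<open>auto simp: numeral_2_eq_2\<close>)
qed


section \<open>Weak subsolutions are viscosity subsolutions\<close>

lemma second_derivative_le_0_at_max:
  fixes f f' :: "real \<Rightarrow> real"
  assumes f: "\<And>y. (f has_real_derivative f' y) (at y)"
    and f': "(f' has_real_derivative f'') (at x)"
    and max: "\<And>y. \<bar>y - x\<bar> < d \<Longrightarrow> f y \<le> f x" and "d > 0"
  shows "f'' \<le> 0"
proof (rule ccontr)
  assume "\<not> f'' \<le> 0"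
  have f'x: "f' x = 0"
    by (rule DERIV_local_max[OF f \<open>d > 0\<close>]) (use max in \<open>auto simp: abs_minus_commute\<close>)
  obtain e where e: "e > 0" "\<And>h. 0 < h \<Longrightarrow> h < e \<Longrightarrow> f' x < f' (x + h)"
    using DERIV_pos_inc_right[OF f'] \<open>\<not> f'' \<le> 0\<close> by auto
  define h where "h = min e d / 2"
  have h: "0 < h" "h < e" "h < d" using e(1) \<open>d > 0\<close> by (auto simp: h_def min_def)
  obtain c where c: "x < c" "c < x + h" "f (x + h) - f x = (x + h - x) * f' c"
    using MVT2[of x "x + h" f f'] f h by auto
  have "f' c > 0" using e(2)[of "c - x"] c h f'x by auto
  then have "f (x + h) > f x" using c h by (simp add: algebra_simps)
  then show False using max[of "x + h"] h by auto
qed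

text \<open>Weak subsolutions are viscosity subsolutions: a smooth function that touches \<open>u\<close> from above at \<open>(x, t)\<close>, over a
  neighbourhood of \<open>(x, t)\<close> in the past, satisfies the differential inequality at that point. This is the only form in
  which the equation is used below; it replaces the maximum principle and the Hopf lemma, and spares any regularity
  theory for \<open>\<partial>\<^sub>x u\<close>.

  For smooth \<open>u\<close> this is the derivative test at a maximum. In general, \<open>u\<close> is replaced by a uniformly close
  smooth subsolution; an added penalty makes the maximum strict, so that it is not lost to the approximation.\<close>

lemma heat_subsol_touching:
  fixes x t \<rho> k :: real and \<psi> \<psi>x \<psi>xx \<psi>t :: "real \<times> real \<Rightarrow> real"
  assumes u: "continuous_on (cbox (x - \<rho>, t - \<rho>) (x + \<rho>, t)) u"
    and sub: "heat_subsol u k (box (x - \<rho>, t - \<rho>) (x + \<rho>, t))"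
    and "\<rho> > 0"
    and \<psi>x: "\<And>y s. ((\<lambda>y. \<psi> (y, s)) has_real_derivative \<psi>x (y, s)) (at y)"
    and \<psi>xx: "\<And>y s. ((\<lambda>y. \<psi>x (y, s)) has_real_derivative \<psi>xx (y, s)) (at y)"
    and \<psi>t: "\<And>y s. ((\<lambda>s. \<psi> (y, s)) has_real_derivative \<psi>t (y, s)) (at s)"
    and cont: "continuous_on UNIV \<psi>" "continuous_on UNIV \<psi>xx" "continuous_on UNIV \<psi>t"
    and touch: "\<And>z. z \<in> cbox (x - \<rho>, t - \<rho>) (x + \<rho>, t) \<Longrightarrow> u z - \<psi> z \<le> u (x, t) - \<psi> (x, t)"
  shows "\<psi>t (x, t) - \<psi>xx (x, t) \<le> k"
proof (rule ccontr)
  assume "\<not> \<psi>t (x, t) - \<psi>xx (x, t) \<le> k"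
  \<comment> \<open>the operator applied to the penalised test function; at \<open>(x, t)\<close> the penalty has no effect\<close>
  define G where "G = (\<lambda>z. \<psi>t z + 2 * (snd z - t) - (\<psi>xx z + 12 * (fst z - x)\<^sup>2))"
  have "isCont G (x, t)"
    using continuous_on_interior[OF cont(2), of "(x, t)"] continuous_on_interior[OF cont(3), of "(x, t)"]
    unfolding G_def by (auto intro!: continuous_intros)
  then obtain d where "d > 0" and d: "\<And>z. dist z (x, t) < d \<Longrightarrow> dist (G z) (G (x, t)) < G (x, t) - k"
    using \<open>\<not> \<psi>t (x, t) - \<psi>xx (x, t) \<le> k\<close> unfolding continuous_at_eps_delta dist_norm
    by (metis G_def diff_gt_0_iff_gt diff_self fst_conv linorder_not_le mult_zero_right snd_conv
        add.right_neutral zero_power2)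
  define \<rho>' where "\<rho>' = min (\<rho> / 2) (d / 3)"
  have \<rho>': "0 < \<rho>'" "\<rho>' < \<rho>" "2 * \<rho>' < d" using \<open>d > 0\<close> \<open>\<rho> > 0\<close> by (auto simp: \<rho>'_def min_def)
  let ?C = "cbox (x - \<rho>', t - \<rho>') (x + \<rho>', t)"
  have G: "G z > k" if "z \<in> ?C" for z
  proof -
    have "dist z (x, t) \<le> \<bar>fst z - x\<bar> + \<bar>snd z - t\<bar>"
      by (simp add: dist_prod_def dist_real_def sqrt_sum_squares_le_sum_abs)
    also have "\<dots> \<le> 2 * \<rho>'" using that by (auto simp: cbox_Pair_iff)
    also have "\<dots> < d" by (rule \<rho>'(3))
    finally show ?thesis using d[of z] by (auto simp: dist_real_def)
  qed
  define \<theta> where "\<theta> = (\<lambda>z. \<psi> z + (fst z - x) ^ 4 + (snd z - t)\<^sup>2)"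
  define M where "M = u (x, t) - \<psi> (x, t)"
  \<comment> \<open>a third of the least value of the penalty on the sides and at the bottom of \<open>?C\<close>, where the maximum must not lie\<close>
  define \<mu> where "\<mu> = min (\<rho>' ^ 4) (\<rho>'\<^sup>2) / 3"
  have \<mu>: "\<mu> > 0" "3 * \<mu> \<le> \<rho>' ^ 4" "3 * \<mu> \<le> \<rho>'\<^sup>2" using \<rho>' by (auto simp: \<mu>_def)
  obtain v vx vxx vt :: "real \<times> real \<Rightarrow> real" where v:
    "\<And>x t. ((\<lambda>y. v (y, t)) has_real_derivative vx (x, t)) (at x)"
    "\<And>x t. ((\<lambda>y. vx (y, t)) has_real_derivative vxx (x, t)) (at x)"
    "\<And>x t. ((\<lambda>s. v (x, s)) has_real_derivative vt (x, t)) (at t)"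
    "\<And>z. z \<in> ?C \<Longrightarrow> vt z - vxx z \<le> k"
    "\<And>z. z \<in> ?C \<Longrightarrow> \<bar>v z - u z\<bar> \<le> \<mu>"
    "continuous_on UNIV v"
    by (rule mollify_subsol[OF u sub, of "x - \<rho>'" "x + \<rho>'" "t - \<rho>'" t \<mu>]) (use \<mu>(1) \<rho>' in auto)
  have "continuous_on ?C (\<lambda>z. v z - \<theta> z)"
    unfolding \<theta>_def by (intro continuous_intros continuous_on_subset[OF cont(1)] continuous_on_subset[OF v(6)]) auto
  moreover have xtC: "(x, t) \<in> ?C" using \<rho>' by (simp add: cbox_Pair_iff)
  ultimately obtain z where z: "z \<in> ?C" "\<And>\<zeta>. \<zeta> \<in> ?C \<Longrightarrow> v \<zeta> - \<theta> \<zeta> \<le> v z - \<theta> z"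
    using continuous_attains_sup[OF compact_cbox, of _ _ "\<lambda>z. v z - \<theta> z"] by blast
  obtain y s where ys: "z = (y, s)" by (cases z)
  have max: "v (y', s') - \<theta> (y', s') \<le> v (y, s) - \<theta> (y, s)"
    if "\<bar>y' - x\<bar> \<le> \<rho>'" "t - \<rho>' \<le> s'" "s' \<le> t" for y' s'
  proof -
    have "(y', s') \<in> ?C" using that unfolding cbox_Pair_iff fst_conv snd_conv by linarith
    then show ?thesis using z(2) ys by blast
  qed
  have "v (x, t) - \<theta> (x, t) \<ge> M - \<mu>"
    using v(5)[OF xtC] by (auto simp: \<theta>_def M_def)
  then have "v z - \<theta> z \<ge> M - \<mu>" using z(2)[OF xtC] by simp
  moreover have "v z \<le> u z + \<mu>" using v(5)[OF z(1)] by simp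
  moreover have "u z - \<psi> z \<le> M"
    unfolding M_def by (rule touch) (use z(1) \<rho>' in \<open>auto simp: cbox_Pair_iff\<close>)
  ultimately have pen: "(y - x) ^ 4 + (s - t)\<^sup>2 \<le> 2 * \<mu>"
    by (simp add: \<theta>_def ys)
  have y: "\<bar>y - x\<bar> < \<rho>'"
  proof (rule ccontr)
    assume "\<not> \<bar>y - x\<bar> < \<rho>'"
    then have "\<rho>' ^ 4 \<le> \<bar>y - x\<bar> ^ 4" using \<rho>' by (intro power_mono) auto
    then show False using pen \<mu> zero_le_power2[of "s - t"] by (simp add: power_even_abs)
  qed
  have s: "\<bar>s - t\<bar> < \<rho>'"
  proof (rule ccontr)
    assume "\<not> \<bar>s - t\<bar> < \<rho>'"
    then have "\<rho>'\<^sup>2 \<le> \<bar>s - t\<bar>\<^sup>2" using \<rho>' by (intro power_mono) auto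
    moreover have "(y - x) ^ 4 \<ge> 0" by simp
    ultimately show False using pen \<mu> by simp
  qed
  have "s \<le> t" using z(1) by (simp add: ys cbox_Pair_iff)
  have "vt (y, s) - (\<psi>t (y, s) + 2 * (s - t)) \<ge> 0"
  proof (rule ccontr)
    assume neg: "\<not> vt (y, s) - (\<psi>t (y, s) + 2 * (s - t)) \<ge> 0"
    have "((\<lambda>s'. (s' - t)\<^sup>2) has_real_derivative 2 * (s - t)) (at s)"
      by (auto intro!: derivative_eq_intros)
    then have "((\<lambda>s'. v (y, s') - (\<psi> (y, s') + (y - x) ^ 4 + (s' - t)\<^sup>2)) has_real_derivative
        vt (y, s) - (\<psi>t (y, s) + 0 + 2 * (s - t))) (at s)"
      by (intro DERIV_diff DERIV_add v(3) \<psi>t DERIV_const)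
    then have "((\<lambda>s'. v (y, s') - \<theta> (y, s')) has_real_derivative
        vt (y, s) - (\<psi>t (y, s) + 2 * (s - t))) (at s)"
      by (simp add: \<theta>_def)
    from DERIV_neg_dec_left[OF this] neg obtain e where e: "e > 0"
      "\<And>h. 0 < h \<Longrightarrow> h < e \<Longrightarrow> v (y, s) - \<theta> (y, s) < v (y, s - h) - \<theta> (y, s - h)"
      by (meson not_le)
    define h where "h = min e (\<rho>' - \<bar>s - t\<bar>) / 2"
    have "0 < h" "h < e" "h < \<rho>' - \<bar>s - t\<bar>" using e s by (auto simp: h_def min_def)
    then show False using e(2)[of h] max[of y "s - h"] y \<open>s \<le> t\<close> by linarith
  qed
  moreover have "vxx (y, s) - (\<psi>xx (y, s) + 12 * (y - x)\<^sup>2) \<le> 0"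
  proof (rule second_derivative_le_0_at_max)
    fix y'
    have "((\<lambda>y. (y - x) ^ 4) has_real_derivative 4 * (y' - x) ^ 3) (at y')"
      by (auto intro!: derivative_eq_intros)
    then have "((\<lambda>y. v (y, s) - (\<psi> (y, s) + (y - x) ^ 4 + (s - t)\<^sup>2)) has_real_derivative
        vx (y', s) - (\<psi>x (y', s) + 4 * (y' - x) ^ 3 + 0)) (at y')"
      by (intro DERIV_diff DERIV_add v(1) \<psi>x DERIV_const)
    then show "((\<lambda>y. v (y, s) - \<theta> (y, s)) has_real_derivative
        vx (y', s) - (\<psi>x (y', s) + 4 * (y' - x) ^ 3)) (at y')"
      by (simp add: \<theta>_def)
  next
    have "((\<lambda>y. 4 * (y - x) ^ 3) has_real_derivative 12 * (y - x)\<^sup>2) (at y)"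
      by (auto intro!: derivative_eq_intros)
    then show "((\<lambda>y. vx (y, s) - (\<psi>x (y, s) + 4 * (y - x) ^ 3)) has_real_derivative
        vxx (y, s) - (\<psi>xx (y, s) + 12 * (y - x)\<^sup>2)) (at y)"
      by (intro DERIV_diff DERIV_add v(2) \<psi>xx)
    show "\<rho>' - \<bar>y - x\<bar> > 0" using y by simp
    show "v (y', s) - \<theta> (y', s) \<le> v (y, s) - \<theta> (y, s)" if "\<bar>y' - y\<bar> < \<rho>' - \<bar>y - x\<bar>" for y'
      by (rule max) (use that s \<open>s \<le> t\<close> in linarith)+
  qed
  ultimately have "G z \<le> vt z - vxx z" by (simp add: G_def ys)
  then show False using G[OF z(1)] v(4)[OF z(1)] by simp
qed

section \<open>From the hysteresis problem to differential inequalities\<close>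

lemma interior_Q: "interior (Q T) = box (0, 0) (1, T)"
proof -
  have "interior {0<..T} = {0<..<T}"
    by simp
  then show ?thesis
    by (auto simp: Q_def Omega_def interior_Times box_Pair_iff)
qed

lemma closure_Q: "T > 0 \<Longrightarrow> closure (Q T) = cbox (0, 0) (1, T)"
  by (auto simp: Q_def Omega_def closure_Times cbox_Pair_iff)

lemma smooth_pd:
  assumes "smooth \<psi>"
  shows "continuous_on UNIV \<psi>" "continuous_on UNIV (pd_t \<psi>)" "continuous_on UNIV (pd_x (pd_x \<psi>))"
proof -
  obtain D where D: "D 0 0 = \<psi>" "\<And>i j. continuous_on UNIV (D i j)"
    "\<And>i j x t. ((\<lambda>y. D i j (y, t)) has_real_derivative D (Suc i) j (x, t)) (at x)"
    "\<And>i j x t. ((\<lambda>s. D i j (x, s)) has_real_derivative D i (Suc j) (x, t)) (at t)"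
    using assms unfolding smooth_def by blast
  have x: "pd_x (D i j) = D (Suc i) j" for i j
    unfolding pd_x_def by (auto simp: fun_eq_iff intro!: DERIV_imp_deriv D)
  have t: "pd_t (D i j) = D i (Suc j)" for i j
    unfolding pd_t_def by (auto simp: fun_eq_iff intro!: DERIV_imp_deriv D)
  show "continuous_on UNIV \<psi>" "continuous_on UNIV (pd_t \<psi>)" "continuous_on UNIV (pd_x (pd_x \<psi>))"
    using D(2) unfolding D(1)[symmetric] x t by blast+
qed

lemma pd_eq_0:
  assumes "open W" "\<And>z. z \<in> W \<Longrightarrow> f z = 0" "z \<in> W"
  shows "pd_x f z = 0" "pd_t f z = 0"
proof -
  obtain x t where z: "z = (x, t)" by (cases z)
  have "open ((\<lambda>y. (y, t)) -` W)"
    by (rule open_vimage[OF assms(1)]) (intro continuous_intros)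
  then have "((\<lambda>y. f (y, t)) has_real_derivative 0) (at x)"
    using has_field_derivative_transform_within_open[OF DERIV_const[of 0], of _ x "\<lambda>y. f (y, t)"] assms
    by (auto simp: z)
  then show "pd_x f z = 0" by (simp add: pd_x_def z DERIV_imp_deriv)
  have "open ((\<lambda>s. (x, s)) -` W)"
    by (rule open_vimage[OF assms(1)]) (intro continuous_intros)
  then have "((\<lambda>s. f (x, s)) has_real_derivative 0) (at t)"
    using has_field_derivative_transform_within_open[OF DERIV_const[of 0], of _ t "\<lambda>s. f (x, s)"] assms
    by (auto simp: z)
  then show "pd_t f z = 0" by (simp add: pd_t_def z DERIV_imp_deriv)
qed

lemma Lq_times_bounded_integrable:
  assumes g: "g \<in> Lq q (box a b)" and "1 \<le> q" and \<psi>: "continuous_on (cbox a b) \<psi>"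
  shows "integrable (lebesgue_on (box a b)) (\<lambda>z. g z * \<psi> z)"
proof -
  have "bounded (\<psi> ` cbox a b)"
    by (intro compact_imp_bounded compact_continuous_image \<psi> compact_cbox)
  then obtain B where B: "B > 0" "\<And>z. z \<in> cbox a b \<Longrightarrow> \<bar>\<psi> z\<bar> \<le> B"
    unfolding bounded_pos by auto
  have meas: "\<psi> \<in> borel_measurable (lebesgue_on (box a b))"
    by (intro continuous_imp_measurable_on_sets_lebesgue continuous_on_subset[OF \<psi>] box_subset_cbox) simp
  have fin: "integrable (lebesgue_on (box a b)) (\<lambda>_. 1::real)"
    by (intro finite_measure.integrable_const finite_measure_lebesgue_on) simp
  have "integrable (lebesgue_on (box a b)) (\<lambda>z. (1 + \<bar>g z\<bar> powr q) * B)"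
    using g unfolding Lq_def by (intro integrable_mult_left Bochner_Integration.integrable_add fin) auto
  then show ?thesis
  proof (rule Bochner_Integration.integrable_bound)
    show "(\<lambda>z. g z * \<psi> z) \<in> borel_measurable (lebesgue_on (box a b))"
      using g meas unfolding Lq_def by auto
    show "AE z in lebesgue_on (box a b). norm (g z * \<psi> z) \<le> norm ((1 + \<bar>g z\<bar> powr q) * B)"
    proof (rule AE_I2)
      fix z assume "z \<in> space (lebesgue_on (box a b))"
      then have "z \<in> cbox a b" using box_subset_cbox by auto
      have "\<bar>g z\<bar> \<le> 1 + \<bar>g z\<bar> powr q"
      proof (cases "\<bar>g z\<bar> \<le> 1")
        case False
        then have "\<bar>g z\<bar> powr 1 \<le> \<bar>g z\<bar> powr q" using \<open>1 \<le> q\<close> by (intro powr_mono) auto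
        then show ?thesis using False by simp
      qed (use powr_ge_zero[of "\<bar>g z\<bar>" q] in linarith)
      then show "norm (g z * \<psi> z) \<le> norm ((1 + \<bar>g z\<bar> powr q) * B)"
        using B(1) B(2)[OF \<open>z \<in> cbox a b\<close>] by (auto simp: abs_mult intro!: mult_mono)
    qed
  qed
qed

text \<open>Only upper bounds for the hysteresis term are needed; they pass to the weak formulation without measurability of
  that term, because it agrees almost everywhere with a difference of \<open>L\<^sup>q\<close> functions.\<close>

lemma hysteresis_solution_heat_subsol:
  assumes sol: "hysteresis_solution q \<alpha> \<beta> T \<phi> p u" and "1 \<le> q" "T > 0"
    and V: "open V" "V \<subseteq> box (0, 0) (1, T)"
    and le: "\<And>z. z \<in> V \<Longrightarrow> hyst \<alpha> \<beta> T p u z \<le> k"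
  shows "heat_subsol u k V"
  unfolding heat_subsol_def
proof (intro ballI impI)
  let ?U = "box (0, 0) (1, T)"
  have u: "continuous_on (cbox (0, 0) (1, T)) u"
    using sol \<open>T > 0\<close> unfolding hysteresis_solution_def W21_def by (simp add: closure_Q)
  obtain g h where gh: "g \<in> Lq q ?U" "h \<in> Lq q ?U" "has_weak_dt u g ?U" "has_weak_Laplacian u h ?U"
    and ae: "AE z in lebesgue_on (Q T). g z - h z = hyst \<alpha> \<beta> T p u z"
    using sol unfolding hysteresis_solution_def interior_Q by blast
  fix \<psi> assume \<psi>: "\<psi> \<in> test_functions V" and nonneg: "\<forall>z. 0 \<le> \<psi> z"
  then obtain K where sm: "smooth \<psi>" and K: "compact K" "K \<subseteq> V" "\<And>z. z \<notin> K \<Longrightarrow> \<psi> z = 0"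
    unfolding test_functions_def by blast
  then have \<psi>U: "\<psi> \<in> test_functions ?U"
    using V(2) unfolding test_functions_def by blast
  note c = smooth_pd[OF sm]
  have cK: "open (- K)" using K(1) by (simp add: compact_imp_closed open_Compl)
  have 0: "pd_x \<psi> z = 0" "pd_t \<psi> z = 0" if "z \<notin> K" for z
    using pd_eq_0[OF cK, of \<psi> z] K(3) that by auto
  have 00: "pd_x (pd_x \<psi>) z = 0" if "z \<notin> K" for z
    using pd_eq_0(1)[OF cK, of "pd_x \<psi>" z] 0 that by auto
  have shrink: "(LINT z|lebesgue_on V. f z) = (LINT z|lebesgue_on ?U. f z)"
    if "\<And>z. z \<notin> K \<Longrightarrow> f z = 0" for f :: "real \<times> real \<Rightarrow> real"
  proof -
    have "(LINT z|lebesgue_on V. f z) = (LINT z|lebesgue. indicator V z *\<^sub>R f z)"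
      using V(1) by (intro integral_restrict_space) auto
    also have "\<dots> = (LINT z|lebesgue. indicator ?U z *\<^sub>R f z)"
      using that K(2) V(2) by (intro Bochner_Integration.integral_cong) (auto simp: indicator_def)
    also have "\<dots> = (LINT z|lebesgue_on ?U. f z)"
      by (intro integral_restrict_space[symmetric]) auto
    finally show ?thesis .
  qed
  have int: "integrable (lebesgue_on ?U) f" if "continuous_on (cbox (0, 0) (1, T)) f" for f :: "real \<times> real \<Rightarrow> real"
  proof -
    have "set_integrable lebesgue ?U f"
      by (rule set_integrable_subset[OF absolutely_integrable_continuous[OF that]])
         (auto simp: box_subset_cbox)
    then show ?thesis
      by (simp add: integrable_restrict_space set_integrable_def)
  qed
  note sub = continuous_on_subset[OF c(1) subset_UNIV] continuous_on_subset[OF c(2) subset_UNIV]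
    continuous_on_subset[OF c(3) subset_UNIV]
  have ig: "integrable (lebesgue_on ?U) (\<lambda>z. g z * \<psi> z)" 
    and ih: "integrable (lebesgue_on ?U) (\<lambda>z. h z * \<psi> z)"
    using Lq_times_bounded_integrable[OF _ \<open>1 \<le> q\<close> sub(1)] gh by blast+
  have "AE z in lebesgue. z \<in> Q T \<longrightarrow> g z - h z = hyst \<alpha> \<beta> T p u z"
  proof -
    have "Q T \<in> sets borel" unfolding Q_def Omega_def by (intro borel_Times) auto
    then have "Q T \<in> sets lebesgue" by (metis sets_completionI_sets sets_lborel)
    then show ?thesis using ae by (subst (asm) AE_restrict_space_iff) auto
  qed
  then have "AE z in lebesgue_on ?U. g z - h z = hyst \<alpha> \<beta> T p u z"
    using interior_subset[of "Q T"] unfolding interior_Q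
    by (subst AE_restrict_space_iff) auto
  then have "AE z in lebesgue_on ?U. g z * \<psi> z - h z * \<psi> z \<le> k * \<psi> z"
  proof eventually_elim
    case (elim z)
    show ?case
    proof (cases "z \<in> V")
      case True
      then have "(g z - h z) * \<psi> z \<le> k * \<psi> z"
        using le[OF True] nonneg[rule_format, of z] elim by (intro mult_right_mono) simp_all
      then show ?thesis by (simp add: algebra_simps)
    next
      case False
      then have "\<psi> z = 0" using K(2,3) by blast
      then show ?thesis by simp
    qed
  qed
  then have "(LINT z|lebesgue_on ?U. g z * \<psi> z - h z * \<psi> z) \<le> (LINT z|lebesgue_on ?U. k * \<psi> z)"
    by (intro integral_mono_AE Bochner_Integration.integrable_diff ig ih int continuous_intros sub)
  then have "- k * (LINT z|lebesgue_on ?U. \<psi> z) \<le>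
      - (LINT z|lebesgue_on ?U. g z * \<psi> z) + (LINT z|lebesgue_on ?U. h z * \<psi> z)"
    using ig ih by simp
  also have "- (LINT z|lebesgue_on ?U. g z * \<psi> z) = (LINT z|lebesgue_on ?U. u z * pd_t \<psi> z)"
    using gh(3) \<psi>U unfolding has_weak_dt_def by simp
  also have "(LINT z|lebesgue_on ?U. h z * \<psi> z) = (LINT z|lebesgue_on ?U. u z * pd_x (pd_x \<psi>) z)"
    using gh(4) \<psi>U unfolding has_weak_Laplacian_def by simp
  also have "(LINT z|lebesgue_on ?U. u z * pd_t \<psi> z) + \<dots> =
      (LINT z|lebesgue_on ?U. u z * (pd_t \<psi> z + pd_x (pd_x \<psi>) z))"
    unfolding ring_distribs
    by (intro Bochner_Integration.integral_add[symmetric] int continuous_intros sub u)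
  also have "\<dots> = (LINT z|lebesgue_on V. u z * (pd_t \<psi> z + pd_x (pd_x \<psi>) z))"
    by (rule shrink[symmetric]) (simp add: 0 00)
  also have "(LINT z|lebesgue_on ?U. \<psi> z) = (LINT z|lebesgue_on V. \<psi> z)"
    by (rule shrink[symmetric]) (rule K(3))
  finally show "- k * (LINT z|lebesgue_on V. \<psi> z)
      \<le> (LINT z|lebesgue_on V. u z * (pd_t \<psi> z + pd_x (pd_x \<psi>) z))" .
qed

lemma hyst_le_1:
  assumes "initial_phase \<alpha> \<beta> \<phi> p" and "fst z \<in> Omega"
  shows "hyst \<alpha> \<beta> T p u z \<le> 1"
  using assms by (cases z) (auto simp: hyst_def hyst_on_E_def initial_phase_def)

text \<open>The last point of the threshold set before \<open>t\<close> cannot lie on the threshold \<open>\<alpha>\<close>, so it carries phase II. If it is at time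
  \<open>0\<close>, then \<open>s0 = 0\<close> and the consistency of the initial phase applies.\<close>

lemma hyst_switched:
  assumes init: "initial_phase \<alpha> \<beta> \<phi> p" and x: "x \<in> Omega" and t: "0 < t" "t \<le> T"
    and cont: "continuous_on {0..t} (\<lambda>s. u (x, s))"
    and above: "\<And>s. 0 < s \<Longrightarrow> s \<le> t \<Longrightarrow> u (x, s) > \<alpha>"
    and u0: "u (x, 0) = \<phi> x"
    and s0: "s0 \<in> {0..t}" "u (x, s0) \<ge> \<beta>"
  shows "hyst \<alpha> \<beta> T p u (x, t) = -1"
proof (cases "(x, t) \<in> hyst_E \<alpha> \<beta> T u")
  case True
  then show ?thesis using above[of t] t by (simp add: hyst_def hyst_on_E_def)
next
  case False
  define M where "M = {s \<in> {0..t}. u (x, s) \<ge> \<beta>}"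
  have M_E: "(x, s) \<in> hyst_E \<alpha> \<beta> T u \<longleftrightarrow> s = 0 \<or> s \<in> M" if "s \<le> t" for s
    using that above[of s] x t by (auto simp: hyst_E_def Q_def M_def)
  have "M = {0..t} \<inter> (\<lambda>s. u (x, s)) -` {\<beta>..}" by (auto simp: M_def)
  then have "closed M" using continuous_closed_preimage[OF cont] by simp
  moreover have "M \<noteq> {}" using s0 by (auto simp: M_def)
  moreover have bdd: "bdd_above M" by (rule bdd_aboveI[of _ t]) (simp add: M_def)
  ultimately have SM: "Sup M \<in> M" by (metis closed_contains_Sup)
  have "(GREATEST s. s \<le> t \<and> (x, s) \<in> hyst_E \<alpha> \<beta> T u) = Sup M"
  proof (rule Greatest_equality)
    show "Sup M \<le> t \<and> (x, Sup M) \<in> hyst_E \<alpha> \<beta> T u"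
      using SM M_E[of "Sup M"] by (auto simp: M_def)
    fix s assume "s \<le> t \<and> (x, s) \<in> hyst_E \<alpha> \<beta> T u"
    then have "s = 0 \<or> s \<in> M" using M_E by blast
    moreover have "0 \<le> Sup M" using SM unfolding M_def by simp
    ultimately show "s \<le> Sup M" using cSup_upper[OF _ bdd] by auto
  qed
  then have "hyst \<alpha> \<beta> T p u (x, t) = hyst_on_E \<alpha> p u (x, Sup M)"
    using False by (simp add: hyst_def hyst_tau_def)
  also have "\<dots> = -1"
  proof (cases "Sup M = 0")
    case True
    then have "\<phi> x \<ge> \<beta>" using SM u0 by (simp add: M_def)
    then show ?thesis using True init x by (simp add: hyst_on_E_def initial_phase_def)
  next
    case False
    then show ?thesis using SM above[of "Sup M"] by (simp add: hyst_on_E_def M_def)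
  qed
  finally show ?thesis .
qed

lemma switch_time_attained:
  assumes cont: "continuous_on {0..T} (\<lambda>t. u (x, t))" and less: "switch_time \<beta> T u x < T"
  shows "switch_time \<beta> T u x \<in> {0..<T}" "u (x, switch_time \<beta> T u x) \<ge> \<beta>"
proof -
  let ?M = "{t \<in> {0..<T}. u (x, t) \<ge> \<beta>}"
  have r: "switch_time \<beta> T u x = Inf ?M" and "\<not> (\<forall>t\<in>{0..<T}. u (x, t) < \<beta>)"
    using less by (auto simp: switch_time_def split: if_splits)
  then obtain t where t: "t \<in> ?M" by (auto simp: not_less)
  define M where "M = {t \<in> {0..T}. u (x, t) \<ge> \<beta>}"
  have bdd: "bdd_below ?M" "bdd_below M" by (auto simp: M_def intro: bdd_belowI[of _ 0])
  have "M = {0..T} \<inter> (\<lambda>s. u (x, s)) -` {\<beta>..}" by (auto simp: M_def)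
  then have "closed M" using continuous_closed_preimage[OF cont] by simp
  moreover have tM: "t \<in> M" using t by (simp add: M_def)
  ultimately have IM: "Inf M \<in> M" using closed_contains_Inf[of M] bdd by blast
  have "Inf M \<le> t" by (rule cInf_lower[OF tM bdd(2)])
  then have "Inf M \<in> ?M" using IM t by (simp add: M_def)
  then have "Inf ?M \<le> Inf M" by (rule cInf_lower[OF _ bdd(1)])
  moreover have "Inf M \<le> Inf ?M"
    by (rule cInf_superset_mono) (use t bdd in \<open>auto simp: M_def\<close>)
  ultimately have "Inf ?M = Inf M" by simp
  then have "Inf ?M \<in> ?M" using \<open>Inf M \<in> ?M\<close> by (simp only:)
  then show "switch_time \<beta> T u x \<in> {0..<T}" "u (x, switch_time \<beta> T u x) \<ge> \<beta>"
    unfolding r by simp_all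
qed

section \<open>Contact with the threshold\<close>

text \<open>What the proof uses of the hysteresis problem on the strip \<open>{A<..<B}\<close>: the source is at most \<open>1\<close>, and it is \<open>- 1\<close> wherever
  the threshold \<open>\<beta>\<close> has been reached before, since there is no way back to the threshold \<open>\<alpha>\<close>.\<close>

locale switching_strip =
  fixes u :: "real \<times> real \<Rightarrow> real" and \<beta> T A B :: real
  assumes T_pos: "T > 0"
    and cont_u: "continuous_on (cbox (A, 0) (B, T)) u"
    and subsol: "\<And>V. open V \<Longrightarrow> V \<subseteq> box (A, 0) (B, T) \<Longrightarrow> heat_subsol u 1 V"
    and subsol_switched: "\<And>V. open V \<Longrightarrow> V \<subseteq> box (A, 0) (B, T) \<Longrightarrow>
      (\<And>x t. (x, t) \<in> V \<Longrightarrow> \<exists>s\<in>{0..t}. u (x, s) \<ge> \<beta>) \<Longrightarrow> heat_subsol u (- 1) V"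
    and initial_le: "\<And>x. x \<in> {A..B} \<Longrightarrow> u (x, 0) \<le> \<beta>"
    and lateral_less: "\<And>t. t \<in> {0<..<T} \<Longrightarrow> u (A, t) < \<beta> \<and> u (B, t) < \<beta>"
begin

text \<open>Where \<open>u > \<beta>\<close>, the phase is switched and \<open>\<partial>\<^sub>t u - \<partial>\<^sub>x\<^sup>2 u \<le> - 1\<close>; so a maximum of \<open>u\<close> above \<open>\<beta>\<close> can be touched by a
  constant, which is impossible. On the parabolic boundary the hypotheses exclude such a maximum.\<close>

lemma u_le_before_end:
  assumes z: "z \<in> cbox (A, 0) (B, T)" "snd z < T"
  shows "u z \<le> \<beta>"
proof (rule ccontr)
  assume nle: "\<not> u z \<le> \<beta>"
  let ?C = "cbox (A, 0) (B, snd z)"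
  have sub: "?C \<subseteq> cbox (A, 0) (B, T)" using z by (auto simp: cbox_Pair_iff)
  have zC: "z \<in> ?C" using z by (auto simp: cbox_Pair_iff)
  obtain p where p: "p \<in> ?C" "\<And>q. q \<in> ?C \<Longrightarrow> u q \<le> u p"
    using continuous_attains_sup[of ?C u] zC continuous_on_subset[OF cont_u sub] compact_cbox by blast
  obtain x t where xt: "p = (x, t)" by (cases p)
  have u_p: "u (x, t) > \<beta>" using p(2)[OF zC] nle by (simp add: xt)
  have range: "x \<in> {A..B}" "0 \<le> t" "t \<le> snd z" using p(1) by (auto simp: xt cbox_Pair_iff)
  have t: "0 < t" "t < T"
    using initial_le[of x] u_p range z by (cases "t = 0"; force)+
  have x: "A < x" "x < B"
    using lateral_less[of t] u_p range t by (cases "x = A"; cases "x = B"; force)+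
  have "p \<in> cbox (A, 0) (B, T)" using p sub by blast
  then obtain \<delta> where \<delta>: "\<delta> > 0"
    "\<And>q. q \<in> cbox (A, 0) (B, T) \<Longrightarrow> dist q p < \<delta> \<Longrightarrow> dist (u q) (u p) < u p - \<beta>"
    using cont_u u_p unfolding continuous_on_iff xt by (metis diff_gt_0_iff_gt)
  define \<rho> where "\<rho> = min (min (\<delta> / 3) t) (min (x - A) (B - x))"
  have \<rho>: "\<rho> > 0" "\<rho> \<le> \<delta> / 3" "\<rho> \<le> t" "\<rho> \<le> x - A" "\<rho> \<le> B - x"
    using \<delta>(1) t x unfolding \<rho>_def by (simp_all del: le_divide_eq_numeral1 add: min.coboundedI1 min.coboundedI2)
  have inC: "q \<in> ?C" if "q \<in> cbox (x - \<rho>, t - \<rho>) (x + \<rho>, t)" for q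
    using that \<rho> range by (auto simp: cbox_Pair_iff)
  have above: "u q > \<beta>" if q: "q \<in> cbox (x - \<rho>, t - \<rho>) (x + \<rho>, t)" for q
  proof -
    have "dist q p \<le> \<bar>fst q - x\<bar> + \<bar>snd q - t\<bar>"
      by (simp add: xt dist_prod_def dist_real_def sqrt_sum_squares_le_sum_abs)
    also have "\<dots> \<le> 2 * \<rho>" using q by (auto simp: cbox_Pair_iff)
    also have "\<dots> < \<delta>" using \<rho> by simp
    finally show ?thesis using \<delta>(2)[of q] inC[OF q] sub by (auto simp: dist_real_def)
  qed
  have sub': "heat_subsol u (- 1) (box (x - \<rho>, t - \<rho>) (x + \<rho>, t))"
  proof (rule subsol_switched)
    show "box (x - \<rho>, t - \<rho>) (x + \<rho>, t) \<subseteq> box (A, 0) (B, T)"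
      using \<rho> t by (auto simp: box_Pair_iff)
    fix y s assume "(y, s) \<in> box (x - \<rho>, t - \<rho>) (x + \<rho>, t)"
    then show "\<exists>s'\<in>{0..s}. u (y, s') \<ge> \<beta>"
      using above[of "(y, s)"] \<rho> by (intro bexI[of _ s]) (auto simp: box_Pair_iff cbox_Pair_iff)
  qed (rule open_box)
  have cont': "continuous_on (cbox (x - \<rho>, t - \<rho>) (x + \<rho>, t)) u"
    using inC sub by (intro continuous_on_subset[OF cont_u]) blast
  have "(0::real) - 0 \<le> - 1"
    by (rule heat_subsol_touching[OF cont' sub' \<rho>(1), where \<psi> = "\<lambda>_. 0" and \<psi>x = "\<lambda>_. 0"
          and \<psi>xx = "\<lambda>_. 0" and \<psi>t = "\<lambda>_. 0"])
       (use p(2) inC xt in auto)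
  then show False by simp
qed

lemma u_le:
  assumes "z \<in> cbox (A, 0) (B, T)"
  shows "u z \<le> \<beta>"
proof (rule continuous_le_on_closure[of "{A..B} \<times> {0..<T}" u])
  have cl: "closure ({A..B} \<times> {0..<T}) = cbox (A, 0) (B, T)"
    using T_pos by (auto simp: closure_Times cbox_Pair_iff)
  show "continuous_on (closure ({A..B} \<times> {0..<T})) u" "z \<in> closure ({A..B} \<times> {0..<T})"
    using cont_u assms unfolding cl by auto
qed (auto intro!: u_le_before_end simp: cbox_Pair_iff)

text \<open>The switched region cannot reach a contact point \<open>(x, t)\<close> through a wedge \<open>t - m * h < s < t\<close>, where \<open>h\<close> is the distance
  to \<open>x\<close> on the side selected by \<open>e\<close>. In the coordinate \<open>\<xi>\<close>, which travels with the edge of the wedge and vanishes on it, the wedge is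
  \<open>\<xi> < 0\<close>.

  There \<open>\<beta> - u \<ge> 0\<close> is a strict supersolution, so as in Hopf's lemma it grows at least linearly off the edge: it lies
  above the barrier \<open>\<kappa> * (- \<xi>) * (L + \<xi>) * (s - (t - \<tau>))\<close>. Beyond the edge one knows only \<open>u \<le> \<beta>\<close>. These two bounds have
  a concave kink at \<open>\<xi> = 0\<close>, under which \<open>u\<close> is touched from above at \<open>(x, t)\<close> by a parabola in \<open>\<xi>\<close> of arbitrarily large
  curvature. That contradicts the bound \<open>1\<close> for the source.\<close>

lemma no_oblique_touching:
  fixes e m d x t :: real
  assumes x: "A < x" "x < B" and t: "0 < t" "t \<le> T" and contact: "u (x, t) = \<beta>"
    and e: "e = 1 \<or> e = -1" and "m > 0" "d > 0"
    and switched: "\<And>h s. 0 < h \<Longrightarrow> h < d \<Longrightarrow> 0 < s \<Longrightarrow> s < t \<Longrightarrow> t - m * h < s \<Longrightarrow>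
      \<exists>s'\<in>{0..s}. u (x - e * h, s') \<ge> \<beta>"
  shows False
proof -
  define \<sigma> where "\<sigma> = 1 / m"
  have \<sigma>: "\<sigma> > 0" "m * \<sigma> = 1" using \<open>m > 0\<close> by (auto simp: \<sigma>_def)
  define \<xi> where "\<xi> = (\<lambda>z :: real \<times> real. e * (fst z - x) + \<sigma> * (t - snd z))"
  have ee: "e * e = 1" using e by auto
  have cont_\<xi>: "continuous_on S \<xi>" for S unfolding \<xi>_def by (intro continuous_intros)
  have \<xi>x: "((\<lambda>y. \<xi> (y, s)) has_real_derivative e) (at y)" for y s
    unfolding \<xi>_def fst_conv snd_conv by (auto intro!: derivative_eq_intros)
  have \<xi>t: "((\<lambda>s. \<xi> (y, s)) has_real_derivative - \<sigma>) (at s)" for y s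
    unfolding \<xi>_def fst_conv snd_conv by (auto intro!: derivative_eq_intros)
  define d' where "d' = min d (min (x - A) (B - x))"
  have d': "d' > 0" "d' \<le> d" "d' \<le> x - A" "d' \<le> B - x" using x \<open>d > 0\<close> by (auto simp: d'_def)
  \<comment> \<open>\<open>L\<close> and \<open>\<tau>\<close> are so small that the parallelogram \<open>P\<close> below stays within distance \<open>d' / 2\<close> of \<open>x\<close>\<close>
  define L \<tau> where "L = d' / 4" and "\<tau> = min (t / 2) (m * d' / 4)"
  have L: "L > 0" and \<tau>: "\<tau> > 0" "\<tau> < t" and \<sigma>\<tau>: "\<sigma> * \<tau> \<le> d' / 4"
    using d' t \<open>m > 0\<close> by (auto simp: L_def \<tau>_def \<sigma>_def field_simps min_def)
  \<comment> \<open>so small that the heat operator applied to the barrier stays below \<open>1\<close>\<close>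
  define \<kappa> where "\<kappa> = 1 / (1 + \<sigma> * L * \<tau> + L\<^sup>2 + 2 * \<tau>)"
  have den: "1 + \<sigma> * L * \<tau> + L\<^sup>2 + 2 * \<tau> > 0" using \<sigma> L \<tau> by (auto intro!: add_pos_nonneg)
  have \<kappa>: "\<kappa> > 0" "\<kappa> * (\<sigma> * L * \<tau> + L\<^sup>2 + 2 * \<tau>) < 1"
    using den by (auto simp: \<kappa>_def field_simps)
  define P where "P = {z. - L \<le> \<xi> z \<and> \<xi> z \<le> 0 \<and> t - \<tau> \<le> snd z \<and> snd z \<le> t}"
  define f where "f = (\<lambda>z. \<beta> + \<kappa> * (\<xi> z * (L + \<xi> z)) * (snd z - (t - \<tau>)))"
  define h where "h = (\<lambda>z :: real \<times> real. e * (x - fst z))"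
  have h_eq: "x - e * h z = fst z" for z using e by (auto simp: h_def)
  have \<xi>_h: "\<xi> z = \<sigma> * (t - snd z) - h z" for z by (simp add: \<xi>_def h_def algebra_simps)
  have hP: "0 \<le> h z" "h z \<le> d' / 2" if "z \<in> P" for z
  proof -
    have "\<sigma> * (t - snd z) \<le> \<sigma> * \<tau>" "0 \<le> \<sigma> * (t - snd z)"
      using that \<sigma> by (auto simp: P_def intro!: mult_left_mono)
    then show "0 \<le> h z" "h z \<le> d' / 2" using that \<xi>_h[of z] \<sigma>\<tau> by (auto simp: P_def L_def)
  qed
  have hP': "\<bar>h z\<bar> = \<bar>fst z - x\<bar>" for z using e by (auto simp: h_def)
  have P_sub: "z \<in> cbox (A, 0) (B, T)" if "z \<in> P" for z
  proof -
    have "\<bar>fst z - x\<bar> \<le> d' / 2" using hP[OF that] hP'[of z] by linarith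
    then show ?thesis using d' that t \<tau> unfolding P_def cbox_Pair_iff mem_Collect_eq by linarith
  qed
  have barrier: "u z \<le> f z" if zP: "z \<in> P" for z
  proof (rule ccontr)
    assume nle: "\<not> u z \<le> f z"
    have cl: "closed P"
      unfolding P_def Collect_conj_eq
      by (intro closed_Int closed_Collect_le cont_\<xi> continuous_intros)
    have "compact P"
    proof -
      have "P = P \<inter> cbox (A, 0) (B, T)" using P_sub by blast
      then show ?thesis using closed_Int_compact[OF cl compact_cbox] by metis
    qed
    moreover have "continuous_on P (\<lambda>z. u z - f z)"
      unfolding f_def using P_sub by (intro continuous_intros cont_\<xi> continuous_on_subset[OF cont_u]) auto
    ultimately obtain p where p: "p \<in> P" "\<And>q. q \<in> P \<Longrightarrow> u q - f q \<le> u p - f p"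
      using continuous_attains_sup[of P "\<lambda>z. u z - f z"] zP by blast
    obtain y s where ys: "p = (y, s)" by (cases p)
    have pos: "u p - f p > 0" using p(2)[OF zP] nle by simp
    have "u p \<le> \<beta>" using u_le P_sub p(1) by blast
    then have "\<kappa> * (\<xi> p * (L + \<xi> p)) * (s - (t - \<tau>)) \<noteq> 0"
      using pos by (auto simp: f_def ys)
    then have strict: "- L < \<xi> p" "\<xi> p < 0" "t - \<tau> < s" "s \<le> t"
      using p(1) by (auto simp: P_def ys)
    define \<rho> where "\<rho> = min (s - (t - \<tau>)) (min (- \<xi> p) (L + \<xi> p) / (2 * (1 + \<sigma>)))"
    have "\<rho> > 0" using strict \<sigma> by (auto simp: \<rho>_def)
    have "\<rho> \<le> s - (t - \<tau>)" by (simp add: \<rho>_def)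
    have "2 * (1 + \<sigma>) * \<rho> \<le> 2 * (1 + \<sigma>) * (min (- \<xi> p) (L + \<xi> p) / (2 * (1 + \<sigma>)))"
      using \<sigma> by (intro mult_left_mono) (auto simp: \<rho>_def)
    also have "\<dots> = min (- \<xi> p) (L + \<xi> p)" using \<sigma> by (simp add: field_simps)
    finally have \<rho>2: "2 * ((1 + \<sigma>) * \<rho>) \<le> - \<xi> p" "2 * ((1 + \<sigma>) * \<rho>) \<le> L + \<xi> p"
      by (simp_all only: mult.assoc min.bounded_iff)
    have nbhd: "q \<in> P \<and> \<xi> q < 0" if q: "q \<in> cbox (y - \<rho>, s - \<rho>) (y + \<rho>, s)" for q
    proof -
      have "\<xi> q - \<xi> p = e * (fst q - y) + \<sigma> * (s - snd q)"
        by (simp add: \<xi>_def ys algebra_simps)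
      moreover have "\<bar>e * (fst q - y)\<bar> \<le> \<rho>"
        using q e by (auto simp: cbox_Pair_iff)
      moreover have "0 \<le> \<sigma> * (s - snd q)" "\<sigma> * (s - snd q) \<le> \<sigma> * \<rho>"
        using q \<sigma> by (auto simp: cbox_Pair_iff)
      ultimately have "\<bar>\<xi> q - \<xi> p\<bar> \<le> (1 + \<sigma>) * \<rho>" by (simp add: algebra_simps)
      moreover have "(1 + \<sigma>) * \<rho> > 0" using \<sigma> \<open>\<rho> > 0\<close> by simp
      ultimately have "- L \<le> \<xi> q" "\<xi> q < 0" using \<rho>2 by linarith+
      then show ?thesis
        using q \<open>\<rho> \<le> s - (t - \<tau>)\<close> strict by (auto simp: P_def cbox_Pair_iff)
    qed
    have box_sub: "box (y - \<rho>, s - \<rho>) (y + \<rho>, s) \<subseteq> cbox (y - \<rho>, s - \<rho>) (y + \<rho>, s)"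
      by (rule box_subset_cbox)
    have subsol': "heat_subsol u (- 1) (box (y - \<rho>, s - \<rho>) (y + \<rho>, s))"
    proof (rule subsol_switched)
      show "box (y - \<rho>, s - \<rho>) (y + \<rho>, s) \<subseteq> box (A, 0) (B, T)"
      proof
        fix q assume "q \<in> box (y - \<rho>, s - \<rho>) (y + \<rho>, s)"
        moreover from this have "q \<in> P" using nbhd box_sub by blast
        ultimately show "q \<in> box (A, 0) (B, T)"
          using hP[of q] hP'[of q] d' t \<tau> strict unfolding P_def box_Pair_iff mem_Collect_eq by linarith
      qed
      fix y' s' assume q: "(y', s') \<in> box (y - \<rho>, s - \<rho>) (y + \<rho>, s)"
      then have qP: "(y', s') \<in> P" "\<xi> (y', s') < 0" using nbhd box_sub by blast+
      have s': "s' < t" "0 < s'" using q strict qP \<tau> by (auto simp: box_Pair_iff P_def)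
      have *: "\<sigma> * (t - s') < h (y', s')" using qP \<xi>_h[of "(y', s')"] by simp
      then have "m * (\<sigma> * (t - s')) < m * h (y', s')" using \<open>m > 0\<close> by simp
      then have "t - s' < m * h (y', s')" using \<sigma>(2) by (simp add: mult.assoc[symmetric])
      moreover have "0 < \<sigma> * (t - s')" using \<sigma> s' by simp
      ultimately have "\<exists>s''\<in>{0..s'}. u (x - e * h (y', s'), s'') \<ge> \<beta>"
        using hP[OF qP(1)] d' s' * by (intro switched) auto
      then show "\<exists>s''\<in>{0..s'}. u (y', s'') \<ge> \<beta>" by (simp add: h_eq)
    qed (rule open_box)
    have cont': "continuous_on (cbox (y - \<rho>, s - \<rho>) (y + \<rho>, s)) u"
      using nbhd P_sub by (intro continuous_on_subset[OF cont_u]) blast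
    define fx where "fx = (\<lambda>z. \<kappa> * (e * (L + 2 * \<xi> z)) * (snd z - (t - \<tau>)))"
    define fxx where "fxx = (\<lambda>z :: real \<times> real. \<kappa> * 2 * (snd z - (t - \<tau>)))"
    define ft where "ft = (\<lambda>z. \<kappa> * (- \<sigma> * (L + 2 * \<xi> z)) * (snd z - (t - \<tau>)) + \<kappa> * (\<xi> z * (L + \<xi> z)))"
    have "ft (y, s) - fxx (y, s) \<le> - 1"
    proof (rule heat_subsol_touching[OF cont' subsol' \<open>\<rho> > 0\<close>])
      show "((\<lambda>y. f (y, s)) has_real_derivative fx (y, s)) (at y)" for y s
        unfolding f_def fx_def fst_conv snd_conv
        by (auto intro!: derivative_eq_intros \<xi>x \<xi>t simp: algebra_simps)
      show "((\<lambda>y. fx (y, s)) has_real_derivative fxx (y, s)) (at y)" for y s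
        unfolding fxx_def fx_def fst_conv snd_conv
        by (auto intro!: derivative_eq_intros \<xi>x simp: ee)
      show "((\<lambda>s. f (y, s)) has_real_derivative ft (y, s)) (at s)" for y s
        unfolding f_def ft_def fst_conv snd_conv
        by (auto intro!: derivative_eq_intros \<xi>x \<xi>t simp: algebra_simps)
      show "u q - f q \<le> u (y, s) - f (y, s)" if "q \<in> cbox (y - \<rho>, s - \<rho>) (y + \<rho>, s)" for q
        using p(2)[of q] nbhd[OF that] by (simp add: ys)
    qed (auto simp: f_def fxx_def ft_def intro!: continuous_intros cont_\<xi>)
    moreover have "ft (y, s) - fxx (y, s) > - 1"
    proof -
      define w where "w = s - (t - \<tau>)"
      have w: "0 < w" "w \<le> \<tau>" using strict by (auto simp: w_def)
      have 1: "\<sigma> * (L + 2 * \<xi> p) * w \<le> \<sigma> * L * \<tau>"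
      proof -
        have "\<sigma> * (L + 2 * \<xi> p) * w \<le> \<sigma> * L * w" using \<sigma> w strict by (intro mult_right_mono mult_left_mono) auto
        also have "\<dots> \<le> \<sigma> * L * \<tau>" using \<sigma> w L by (intro mult_left_mono) auto
        finally show ?thesis .
      qed
      have 2: "- (\<xi> p * (L + \<xi> p)) \<le> L\<^sup>2"
      proof -
        have "(- \<xi> p) * (L + \<xi> p) \<le> L * L" using strict by (intro mult_mono) auto
        then show ?thesis by (simp add: power2_eq_square)
      qed
      have "\<sigma> * (L + 2 * \<xi> p) * w - \<xi> p * (L + \<xi> p) + 2 * w \<le> \<sigma> * L * \<tau> + L\<^sup>2 + 2 * \<tau>"
        using 1 2 w by linarith
      then have "\<kappa> * (\<sigma> * (L + 2 * \<xi> p) * w - \<xi> p * (L + \<xi> p) + 2 * w) < 1"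
        using \<kappa> mult_left_mono[of _ _ \<kappa>] by (smt (verit))
      moreover have "ft (y, s) - fxx (y, s) = - (\<kappa> * (\<sigma> * (L + 2 * \<xi> p) * w - \<xi> p * (L + \<xi> p) + 2 * w))"
        by (simp add: ft_def fxx_def w_def ys algebra_simps)
      ultimately show ?thesis by simp
    qed
    ultimately show False by simp
  qed
  \<comment> \<open>\<open>c\<close> is the slope that the barrier leaves in the half of \<open>P\<close> next to the edge and to time \<open>t\<close>; the curvature term \<open>2 * K\<close> has to outweigh
    \<open>1\<close> and the speed term \<open>\<sigma> * c / 2\<close>\<close>
  define c K where "c = \<kappa> * L * \<tau> / 4" and "K = 1 + \<sigma> * c"
  have c: "c > 0" "K > 0" using \<kappa> L \<tau> \<sigma> by (auto simp: c_def K_def intro!: add_pos_pos)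
  have linear: "u z \<le> \<beta> + c * \<xi> z" if z: "- (L / 2) \<le> \<xi> z" "\<xi> z \<le> 0" "t - \<tau> / 2 \<le> snd z" "snd z \<le> t" for z
  proof -
    have "u z \<le> f z" using z L \<tau> by (intro barrier) (auto simp: P_def)
    also have "f z \<le> \<beta> + c * \<xi> z"
    proof -
      have "(L / 2) * (\<tau> / 2) \<le> (L + \<xi> z) * (snd z - (t - \<tau>))"
        using z L \<tau> by (intro mult_mono) auto
      then have "\<kappa> * \<xi> z * ((L + \<xi> z) * (snd z - (t - \<tau>))) \<le> \<kappa> * \<xi> z * ((L / 2) * (\<tau> / 2))"
        using z \<kappa> by (intro mult_left_mono_neg) (auto simp: mult_le_0_iff)
      then show ?thesis by (simp add: f_def c_def algebra_simps)
    qed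
    finally show ?thesis .
  qed
  define \<eta> where "\<eta> = min (L / 2) (c / (2 * K))"
  have \<eta>: "\<eta> > 0" "\<eta> \<le> L / 2" "K * \<eta> \<le> c / 2"
    using L c by (auto simp: \<eta>_def min_def field_simps)
  define \<rho> where "\<rho> = min (min (\<eta> / (1 + \<sigma>)) (\<tau> / 2)) (min (x - A) (B - x))"
  have \<rho>: "\<rho> > 0" "\<rho> \<le> \<tau> / 2" "\<rho> \<le> x - A" "\<rho> \<le> B - x" "(1 + \<sigma>) * \<rho> \<le> \<eta>"
  proof -
    show "\<rho> > 0" using \<eta> \<sigma> \<tau> x by (auto simp: \<rho>_def)
    show "\<rho> \<le> \<tau> / 2" "\<rho> \<le> x - A" "\<rho> \<le> B - x"
      unfolding \<rho>_def by (intro min.coboundedI1 min.coboundedI2 order_refl)+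
    have "\<rho> \<le> \<eta> / (1 + \<sigma>)" by (simp add: \<rho>_def)
    then show "(1 + \<sigma>) * \<rho> \<le> \<eta>" using \<sigma> by (simp add: pos_le_divide_eq mult.commute)
  qed
  let ?C = "cbox (x - \<rho>, t - \<rho>) (x + \<rho>, t)"
  have C_sub: "?C \<subseteq> cbox (A, 0) (B, T)" "box (x - \<rho>, t - \<rho>) (x + \<rho>, t) \<subseteq> box (A, 0) (B, T)"
    using \<rho> \<tau> t by (auto simp: cbox_Pair_iff box_Pair_iff)
  define g where "g = (\<lambda>z. \<beta> + c / 2 * \<xi> z - K * (\<xi> z)\<^sup>2)"
  have "\<xi> (x, t) = 0" by (simp add: \<xi>_def)
  have "- \<sigma> * (c / 2 - 2 * K * \<xi> (x, t)) - (- (2 * K)) \<le> 1"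
  proof (rule heat_subsol_touching[where \<psi> = g and \<psi>x = "\<lambda>z. e * (c / 2 - 2 * K * \<xi> z)"
        and \<psi>xx = "\<lambda>_. - (2 * K)" and \<psi>t = "\<lambda>z. - \<sigma> * (c / 2 - 2 * K * \<xi> z)"])
    show "continuous_on ?C u" by (rule continuous_on_subset[OF cont_u C_sub(1)])
    show "heat_subsol u 1 (box (x - \<rho>, t - \<rho>) (x + \<rho>, t))"
      by (rule subsol[OF open_box C_sub(2)])
    show "((\<lambda>y. g (y, s)) has_real_derivative e * (c / 2 - 2 * K * \<xi> (y, s))) (at y)" for y s
      unfolding g_def fst_conv snd_conv
      by (auto intro!: derivative_eq_intros \<xi>x \<xi>t simp: algebra_simps)
    show "((\<lambda>y. e * (c / 2 - 2 * K * \<xi> (y, s))) has_real_derivative - (2 * K)) (at y)" for y s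
      by (auto intro!: derivative_eq_intros \<xi>x simp: ee)
    show "((\<lambda>s. g (y, s)) has_real_derivative - \<sigma> * (c / 2 - 2 * K * \<xi> (y, s))) (at s)" for y s
      unfolding g_def fst_conv snd_conv
      by (auto intro!: derivative_eq_intros \<xi>x \<xi>t simp: algebra_simps)
    fix q assume q: "q \<in> ?C"
    have "\<bar>e * (fst q - x)\<bar> \<le> \<rho>" using q e by (auto simp: cbox_Pair_iff)
    moreover have "0 \<le> \<sigma> * (t - snd q)" "\<sigma> * (t - snd q) \<le> \<sigma> * \<rho>"
      using q \<sigma> by (auto simp: cbox_Pair_iff)
    ultimately have "\<bar>\<xi> q\<bar> \<le> (1 + \<sigma>) * \<rho>" by (simp add: \<xi>_def algebra_simps)
    then have \<xi>q: "\<bar>\<xi> q\<bar> \<le> \<eta>" using \<rho> by simp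
    then have K\<xi>: "K * \<bar>\<xi> q\<bar> \<le> c / 2" using \<eta> c mult_left_mono[of "\<bar>\<xi> q\<bar>" \<eta> K] by linarith
    have "u q \<le> g q"
    proof (cases "\<xi> q \<le> 0")
      case True
      have "u q \<le> \<beta> + c * \<xi> q"
        using True \<xi>q \<eta> q \<rho> by (intro linear) (auto simp: cbox_Pair_iff)
      moreover have "(- \<xi> q) * (K * \<bar>\<xi> q\<bar>) \<le> (- \<xi> q) * (c / 2)"
        using K\<xi> True by (intro mult_left_mono) auto
      ultimately show ?thesis using True by (simp add: g_def power2_eq_square algebra_simps)
    next
      case False
      have "\<xi> q * (K * \<bar>\<xi> q\<bar>) \<le> \<xi> q * (c / 2)"
        using K\<xi> False by (intro mult_left_mono) auto
      moreover have "u q \<le> \<beta>" using u_le q C_sub(1) by blast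
      moreover have "K * (\<xi> q)\<^sup>2 = \<xi> q * (K * \<bar>\<xi> q\<bar>)" "c / 2 * \<xi> q = \<xi> q * (c / 2)"
        using False by (auto simp: power2_eq_square)
      ultimately show ?thesis unfolding g_def by linarith
    qed
    then show "u q - g q \<le> u (x, t) - g (x, t)"
      using contact \<open>\<xi> (x, t) = 0\<close> by (simp add: g_def)
  qed (auto simp: g_def \<rho>(1) intro!: continuous_intros cont_\<xi>)
  then have "2 * K - \<sigma> * c / 2 \<le> 1" using \<open>\<xi> (x, t) = 0\<close> by simp
  moreover have "\<sigma> * c > 0" using \<sigma> c by simp
  ultimately show False by (simp add: K_def)
qed

end

section \<open>The upper envelope of the switching time\<close>

text \<open>The value \<open>R x\<close> at the top of the closure of the graph is the upper semicontinuous envelope of \<open>r\<close>.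
  For large \<open>K\<close> the maximum over the closure of \<open>t - K * (x - z)\<^sup>2\<close> is attained at some \<open>x'\<close> near \<open>z\<close>. If \<open>x' \<noteq> z\<close>, the parabola
  touches the graph from above with nonzero slope, which lies below a line on the side towards \<open>z\<close>; this is what \<open>no_touch\<close>
  forbids. So \<open>x' = z\<close> and \<open>R x \<le> R z + K * (x - z)\<^sup>2\<close>. Exchanging the points shows that \<open>R\<close> has derivative \<open>0\<close>.\<close>

lemma graph_closure_constant:
  fixes r :: "real \<Rightarrow> real" and a b T :: real
  defines "G \<equiv> closure ((\<lambda>x. (x, r x)) ` {a<..<b})"
  assumes "a < b" and r: "\<And>x. x \<in> {a<..<b} \<Longrightarrow> r x \<in> {0..T}"
    and no_touch: "\<And>x t e m d. \<lbrakk>x \<in> {a<..<b}; (x, t) \<in> G; e = 1 \<or> e = -1; m > 0; d > 0;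
      \<And>h. 0 < h \<Longrightarrow> h < d \<Longrightarrow> x - e * h \<in> {a<..<b} \<and> r (x - e * h) \<le> t - m * h\<rbrakk> \<Longrightarrow> False"
  obtains C where "\<And>x. x \<in> {a<..<b} \<Longrightarrow> r x \<le> C" "\<And>x. x \<in> {a<..<b} \<Longrightarrow> (x, C) \<in> G"
proof -
  have G_bound: "t \<in> {0..T}" if "(x, t) \<in> G" for x t
  proof -
    have "G \<subseteq> UNIV \<times> {0..T}"
      unfolding G_def
    proof (rule closure_minimal)
      show "(\<lambda>x. (x, r x)) ` {a<..<b} \<subseteq> UNIV \<times> {0..T}"
        using r by blast
    qed (intro closed_Times closed_UNIV closed_atLeastAtMost)
    then show ?thesis using that by blast
  qed
  have rG: "(x, r x) \<in> G" if "x \<in> {a<..<b}" for x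
    unfolding G_def by (intro closure_subset[THEN subsetD] imageI that)
  have "closed G" by (simp add: G_def)
  define R where "R = (\<lambda>x. Sup {t. (x, t) \<in> G})"
  have bdd: "bdd_above {t. (x, t) \<in> G}" for x
    using G_bound by (intro bdd_aboveI[of _ T]) auto
  have R_ge: "t \<le> R x" if "(x, t) \<in> G" for x t
    unfolding R_def using that by (intro cSup_upper bdd) auto
  have RG: "(x, R x) \<in> G" if "x \<in> {a<..<b}" for x
  proof -
    have "closed (Pair x -` G)"
      by (intro closed_vimage \<open>closed G\<close> continuous_intros)
    moreover have "Pair x -` G = {t. (x, t) \<in> G}" by auto
    ultimately have "closed {t. (x, t) \<in> G}" by simp
    from closed_contains_Sup[OF _ bdd this] rG[OF that] show ?thesis
      unfolding R_def by blast
  qed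
  have parabola: "R x \<le> R z + K * (x - z)\<^sup>2"
    if cd: "a < c" "c < z" "z < d" "d < b" and K: "K > 0" "K * (z - c)\<^sup>2 > T" "K * (d - z)\<^sup>2 > T"
      and x: "x \<in> {c..d}" for x z c d K
  proof -
    let ?f = "\<lambda>p :: real \<times> real. snd p - K * (fst p - z)\<^sup>2"
    let ?S = "G \<inter> cbox (c, 0) (d, T)"
    have "compact ?S" using \<open>closed G\<close> by (intro closed_Int_compact compact_cbox)
    moreover have zS: "(z, r z) \<in> ?S" using rG r cd by (auto simp: cbox_Pair_iff)
    moreover have "continuous_on ?S ?f" by (intro continuous_intros)
    ultimately obtain p where p: "p \<in> ?S" "\<And>q. q \<in> ?S \<Longrightarrow> ?f q \<le> ?f p"
      using continuous_attains_sup[of ?S ?f] by blast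
    obtain x' t' where p_eq: "p = (x', t')" by (cases p)
    have pG: "(x', t') \<in> G" "x' \<in> {c..d}" "t' \<le> T" using p(1) by (auto simp: p_eq cbox_Pair_iff)
    have max: "t - K * (y - z)\<^sup>2 \<le> t' - K * (x' - z)\<^sup>2" if "(y, t) \<in> G" "y \<in> {c..d}" for y t
      using p(2)[of "(y, t)"] that G_bound[OF that(1)] by (auto simp: p_eq cbox_Pair_iff)
    have "x' = z"
    proof (rule ccontr)
      assume "x' \<noteq> z"
      define e w where "e = sgn (x' - z)" and "w = \<bar>x' - z\<bar>"
      have ew: "e = 1 \<or> e = -1" "w > 0" "x' = z + e * w"
        using \<open>x' \<noteq> z\<close> by (auto simp: e_def w_def sgn_if)
      show False
      proof (rule no_touch[of x' t' e "K * w" w])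
        show "x' \<in> {a<..<b}" using pG cd by auto
        show "(x', t') \<in> G" "e = 1 \<or> e = - 1" by fact+
        show "K * w > 0" "w > 0" using K ew by auto
        fix h assume h: "0 < h" "h < w"
        have in_cd: "x' - e * h \<in> {c..d}"
          using pG(2) ew(1) h cd unfolding ew(3) by auto
        then have ab: "x' - e * h \<in> {a<..<b}" using cd by auto
        have "r (x' - e * h) - K * (x' - e * h - z)\<^sup>2 \<le> t' - K * (x' - z)\<^sup>2"
          by (rule max[OF rG[OF ab] in_cd])
        moreover have "(x' - e * h - z)\<^sup>2 = (w - h)\<^sup>2" "(x' - z)\<^sup>2 = w\<^sup>2"
          using ew(1) unfolding ew(3) by (auto simp: power2_eq_square algebra_simps)
        moreover have "K * w\<^sup>2 - K * (w - h)\<^sup>2 = K * w * h + K * h * (w - h)"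
          by (simp add: power2_eq_square algebra_simps)
        moreover have "K * h * (w - h) \<ge> 0" using K h by simp
        ultimately have "r (x' - e * h) \<le> t' - K * w * h" by simp
        then show "x' - e * h \<in> {a<..<b} \<and> r (x' - e * h) \<le> t' - K * w * h"
          using ab by blast
      qed
    qed
    have "R x - K * (x - z)\<^sup>2 \<le> t'"
      using max[OF RG x] x cd \<open>x' = z\<close> by auto
    also have "t' \<le> R z" using pG(1) R_ge \<open>x' = z\<close> by blast
    finally show ?thesis by simp
  qed
  have "T \<ge> 0" using r[of "(a + b) / 2"] \<open>a < b\<close> by auto
  have R_eq: "R p = R q" if pq: "a < p" "p < q" "q < b" for p q
  proof -
    define c d \<delta> where "c = (a + p) / 2" and "d = (q + b) / 2" and "\<delta> = min (p - c) (d - q)"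
    define K where "K = T / \<delta>\<^sup>2 + 1"
    have cd: "a < c" "c < p" "q < d" "d < b" "\<delta> > 0" using pq by (auto simp: c_def d_def \<delta>_def)
    have K: "K > 0" "K * \<delta>\<^sup>2 > T"
    proof -
      show "K > 0" using \<open>T \<ge> 0\<close> by (simp add: K_def add_nonneg_pos)
      have "K * \<delta>\<^sup>2 = T + \<delta>\<^sup>2" using cd by (simp add: K_def distrib_right)
      then show "K * \<delta>\<^sup>2 > T" using cd by simp
    qed
    have le: "R x \<le> R z + K * (x - z)\<^sup>2" if "x \<in> {p..q}" "z \<in> {p..q}" for x z
    proof (rule parabola[of c z d])
      have "\<delta> \<le> z - c" "\<delta> \<le> d - z" using that by (auto simp: \<delta>_def)
      then have "K * \<delta>\<^sup>2 \<le> K * (z - c)\<^sup>2" "K * \<delta>\<^sup>2 \<le> K * (d - z)\<^sup>2"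
        using K cd by (auto intro!: mult_left_mono power_mono)
      then show "K * (z - c)\<^sup>2 > T" "K * (d - z)\<^sup>2 > T" using K(2) by linarith+
    qed (use cd that K in auto)
    have "(R has_real_derivative 0) (at z within {p..q})" if z: "z \<in> {p..q}" for z
    proof -
      have "((\<lambda>x. (R x - R z) / (x - z)) \<longlongrightarrow> 0) (at z within {p..q})"
      proof (rule Lim_null_comparison)
        show "\<forall>\<^sub>F x in at z within {p..q}. norm ((R x - R z) / (x - z)) \<le> K * \<bar>x - z\<bar>"
          unfolding eventually_at_filter
        proof (intro always_eventually allI impI)
          fix x assume x: "x \<noteq> z" "x \<in> {p..q}"
          have "\<bar>R x - R z\<bar> \<le> K * (x - z)\<^sup>2"
            using le[OF x(2) z] le[OF z x(2)] by (simp add: abs_le_iff power2_commute)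
          also have "(x - z)\<^sup>2 = \<bar>x - z\<bar> * \<bar>x - z\<bar>" by (simp add: power2_eq_square)
          finally have "\<bar>R x - R z\<bar> \<le> (K * \<bar>x - z\<bar>) * \<bar>x - z\<bar>" by (simp only: mult.assoc)
          then show "norm ((R x - R z) / (x - z)) \<le> K * \<bar>x - z\<bar>"
            using x(1) unfolding real_norm_def abs_divide by (subst pos_divide_le_eq) auto
        qed
        have "((\<lambda>x. K * \<bar>x - z\<bar>) \<longlongrightarrow> K * \<bar>z - z\<bar>) (at z within {p..q})"
          by (intro tendsto_intros)
        then show "((\<lambda>x. K * \<bar>x - z\<bar>) \<longlongrightarrow> 0) (at z within {p..q})" by simp
      qed
      then show ?thesis by (simp add: has_field_derivative_iff)
    qed
    then obtain k where "\<And>z. z \<in> {p..q} \<Longrightarrow> R z = k"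
      using has_field_derivative_zero_constant[of "{p..q}" R] by auto
    then show ?thesis using pq by auto
  qed
  show thesis
  proof (rule that[of "R ((a + b) / 2)"])
    fix x assume x: "x \<in> {a<..<b}"
    have eq: "R ((a + b) / 2) = R x"
    proof (cases x "(a + b) / 2" rule: linorder_cases)
      case less
      then show ?thesis using R_eq[of x "(a + b) / 2"] x by simp
    next
      case greater
      then show ?thesis using R_eq[of "(a + b) / 2" x] x by simp
    qed (simp only:)
    show "r x \<le> R ((a + b) / 2)" "(x, R ((a + b) / 2)) \<in> G"
      unfolding eq using R_ge[OF rG[OF x]] RG[OF x] by auto
  qed
qed

lemma frequently_le_Limsup:
  fixes f :: "'a \<Rightarrow> ereal"
  assumes "\<And>y. y < c \<Longrightarrow> \<exists>\<^sub>F x in F. y < f x"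
  shows "c \<le> Limsup F f"
proof (rule ccontr)
  assume "\<not> c \<le> Limsup F f"
  then obtain y where y: "Limsup F f < y" "y < c" using dense by (meson not_le)
  have "\<forall>\<^sub>F x in F. \<not> y < f x"
    using Limsup_lessD[OF y(1)] by eventually_elim simp
  then show False using assms[OF y(2)] by (simp add: frequently_def)
qed

text \<open>As \<open>(x, C)\<close> is in the closure of the graph for every \<open>x\<close>, values near \<open>C\<close> occur in every subinterval, in particular
  on each side of \<open>x1\<close>.\<close>

lemma Limsup_graph_closure:
  fixes r :: "real \<Rightarrow> real"
  assumes le: "\<And>x. x \<in> {a<..<b} \<Longrightarrow> r x \<le> C"
    and G: "\<And>x. x \<in> {a<..<b} \<Longrightarrow> (x, C) \<in> closure ((\<lambda>x. (x, r x)) ` {a<..<b})"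
    and x1: "x1 \<in> {a<..<b}"
  shows "Limsup (at_left x1) (\<lambda>x. ereal (r x)) = ereal C"
    and "Limsup (at_right x1) (\<lambda>x. ereal (r x)) = ereal C"
    and "Limsup (at x1) (\<lambda>x. ereal (r x)) = ereal C"
proof -
  have near: "\<exists>x. x \<in> {p<..<q} \<and> y < r x" if "a < p" "p < q" "q < b" "y < C" for p q y
  proof -
    let ?W = "{p<..<q} \<times> {y<..}"
    have "open ?W" by (intro open_Times) auto
    moreover have "((p + q) / 2, C) \<in> ?W \<inter> closure ((\<lambda>x. (x, r x)) ` {a<..<b})"
      using G[of "(p + q) / 2"] that by auto
    ultimately have "?W \<inter> (\<lambda>x. (x, r x)) ` {a<..<b} \<noteq> {}"
      using open_Int_closure_eq_empty by blast
    then show ?thesis by auto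
  qed
  have ev: "\<forall>\<^sub>F x in at x1. ereal (r x) \<le> ereal C"
    using x1 le by (auto simp: eventually_at_topological intro!: exI[of _ "{a<..<b}"])
  then have ev': "\<forall>\<^sub>F x in at_left x1. ereal (r x) \<le> ereal C" "\<forall>\<^sub>F x in at_right x1. ereal (r x) \<le> ereal C"
    using eventually_at_split by blast+
  have left: "\<exists>\<^sub>F x in at_left x1. y < ereal (r x)" if yC: "y < ereal C" for y
    unfolding frequently_def
  proof
    assume "\<forall>\<^sub>F x in at_left x1. \<not> y < ereal (r x)"
    then obtain c where c: "c < x1" "\<And>x. c < x \<Longrightarrow> x < x1 \<Longrightarrow> \<not> y < ereal (r x)"
      using x1 by (auto simp: eventually_at_left[of a])
    obtain y' where y': "y < ereal y'" "y' < C"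
      using ereal_dense2[OF yC] by auto
    define p where "p = (max a c + x1) / 2"
    have p: "a < p" "c < p" "p < x1" using c x1 by (auto simp: p_def)
    show False using near[of p x1 y'] c(2) p x1 y'
      by (metis greaterThanLessThan_iff less_ereal.simps(1) less_trans)
  qed
  have right: "\<exists>\<^sub>F x in at_right x1. y < ereal (r x)" if yC: "y < ereal C" for y
    unfolding frequently_def
  proof
    assume "\<forall>\<^sub>F x in at_right x1. \<not> y < ereal (r x)"
    then obtain c where c: "x1 < c" "\<And>x. x1 < x \<Longrightarrow> x < c \<Longrightarrow> \<not> y < ereal (r x)"
      using x1 by (auto simp: eventually_at_right[of _ b])
    obtain y' where y': "y < ereal y'" "y' < C"
      using ereal_dense2[OF yC] by auto
    define p where "p = (min b c + x1) / 2"
    have p: "p < b" "p < c" "x1 < p" using c x1 by (auto simp: p_def min_def)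
    show False using near[of x1 p y'] c(2) p x1 y'
      by (metis greaterThanLessThan_iff less_ereal.simps(1) less_trans)
  qed
  have "at_left x1 \<le> at x1" by (rule at_le) simp
  then have mid: "\<exists>\<^sub>F x in at x1. y < ereal (r x)" if "y < ereal C" for y
    using left[OF that] unfolding frequently_def by (metis filter_leD)
  show "Limsup (at_left x1) (\<lambda>x. ereal (r x)) = ereal C"
    "Limsup (at_right x1) (\<lambda>x. ereal (r x)) = ereal C"
    "Limsup (at x1) (\<lambda>x. ereal (r x)) = ereal C"
    using ev ev' left right mid by (intro antisym Limsup_bounded frequently_le_Limsup; blast)+
qed

section \<open>Switching times of nontransverse solutions\<close>

theorem mainTheorem4:
  fixes q \<alpha> \<beta> T1 x0 \<epsilon> \<epsilon>1 a b :: real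
    and \<phi> p :: "real \<Rightarrow> real"
    and u :: "real \<times> real \<Rightarrow> real"
  assumes "\<alpha> < 0" and "0 < \<beta>"
    and "q > 3" and "T1 > 0"
    and "\<phi> \<in> W_trace q"
    and "(\<phi> has_real_derivative 0) (at 0 within closure Omega)"
    and "(\<phi> has_real_derivative 0) (at 1 within closure Omega)"
    and "initial_phase \<alpha> \<beta> \<phi> p"
    and "hysteresis_solution q \<alpha> \<beta> T1 \<phi> p u"
    and "x0 \<in> Omega" and "top_nontransverse_at \<beta> \<phi> p x0 \<epsilon>"
    and "0 < \<epsilon>1" and "\<epsilon>1 < \<epsilon>"
    and "\<And>x t. x \<in> {x0 - \<epsilon>1<..<x0 + \<epsilon>1} \<Longrightarrow> t \<in> {0<..<T1} \<Longrightarrow> u (x, t) > \<alpha>"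
    and "\<And>t. t \<in> {0<..<T1} \<Longrightarrow> u (x0 - \<epsilon>1, t) < \<beta> \<and> u (x0 + \<epsilon>1, t) < \<beta>"
    and "a < b" and "{a<..<b} \<subseteq> {x0 - \<epsilon>1<..<x0 + \<epsilon>1}"
    and "\<And>x. x \<in> {a<..<b} \<Longrightarrow> switch_time \<beta> T1 u x < T1"
  shows "(continuous_on {a<..<b} (switch_time \<beta> T1 u) \<longrightarrow>
            switch_time \<beta> T1 u constant_on {a<..<b}) \<and>
         (\<forall>x1\<in>{a<..<b}.
            Limsup (at_left x1) (\<lambda>x. ereal (switch_time \<beta> T1 u x)) =
            Limsup (at_right x1) (\<lambda>x. ereal (switch_time \<beta> T1 u x))) \<and>
         limsup_fun (switch_time \<beta> T1 u) constant_on {a<..<b} \<and>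
         (\<forall>x1\<in>{a<..<b}. u (x1, limsup_fun (switch_time \<beta> T1 u) x1) = \<beta>)"
proof -
  let ?r = "switch_time \<beta> T1 u"
  define A B where "A = x0 - \<epsilon>1" and "B = x0 + \<epsilon>1"
  note above = assms(14)[folded A_def B_def] and lateral = assms(15)[folded A_def B_def]
    and ab = assms(17)[folded A_def B_def]
  have "{x0 - \<epsilon><..<x0 + \<epsilon>} \<subseteq> Omega" and phi_x0: "\<phi> x0 = \<beta>"
    and phi_less: "\<And>x. x \<in> {x0 - \<epsilon><..<x0} \<union> {x0<..<x0 + \<epsilon>} \<Longrightarrow> \<phi> x < \<beta>"
    using assms(11) unfolding top_nontransverse_at_def by blast+
  moreover have near: "{A..B} \<subseteq> {x0 - \<epsilon><..<x0 + \<epsilon>}"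
    using assms(13) by (auto simp: A_def B_def)
  ultimately have Omega: "{A..B} \<subseteq> Omega" by blast
  have phi_le: "\<phi> x \<le> \<beta>" if "x \<in> {A..B}" for x
    using phi_less[of x] phi_x0 subsetD[OF near that] by (cases x x0 rule: linorder_cases) auto
  have u_init: "u (x, 0) = \<phi> x" if "x \<in> Omega" for x
    using assms(9) that unfolding hysteresis_solution_def by blast
  have cont: "continuous_on (cbox (0, 0) (1, T1)) u"
    using assms(4,9) unfolding hysteresis_solution_def W21_def by (simp add: closure_Q)
  have sub: "cbox (A, 0) (B, T1) \<subseteq> cbox (0, 0) (1, T1)" "box (A, 0) (B, T1) \<subseteq> box (0, 0) (1, T1)"
    "box (A, 0) (B, T1) \<subseteq> Omega \<times> {0<..<T1}"
  proof -
    have "0 < x \<and> x < 1" if "A \<le> x" "x \<le> B" for x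
      using Omega that by (auto simp: Omega_def)
    then show "cbox (A, 0) (B, T1) \<subseteq> cbox (0, 0) (1, T1)" "box (A, 0) (B, T1) \<subseteq> box (0, 0) (1, T1)"
      "box (A, 0) (B, T1) \<subseteq> Omega \<times> {0<..<T1}"
      by (force simp: cbox_Pair_iff box_Pair_iff Omega_def)+
  qed
  have cont_t: "continuous_on {0..t} (\<lambda>s. u (x, s))" if "x \<in> {A<..<B}" "t \<le> T1" for x t
    by (rule continuous_on_compose2[OF continuous_on_subset[OF cont sub(1)]])
       (use that in \<open>auto intro!: continuous_intros simp: cbox_Pair_iff\<close>)
  have heat: "heat_subsol u k V"
    if "open V" "V \<subseteq> box (A, 0) (B, T1)" "\<And>z. z \<in> V \<Longrightarrow> hyst \<alpha> \<beta> T1 p u z \<le> k" for V k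
    using hysteresis_solution_heat_subsol[OF assms(9) _ assms(4) that(1) _ that(3)] that(2) sub(2) assms(3)
    by simp
  interpret switching_strip u \<beta> T1 A B
  proof
    show "T1 > 0" "continuous_on (cbox (A, 0) (B, T1)) u"
      using assms(4) continuous_on_subset[OF cont sub(1)] by auto
    show "heat_subsol u 1 V" if "open V" "V \<subseteq> box (A, 0) (B, T1)" for V
      using that sub(3) by (intro heat hyst_le_1[OF assms(8)]) auto
    show "heat_subsol u (- 1) V" if V: "open V" "V \<subseteq> box (A, 0) (B, T1)"
      and sw: "\<And>x t. (x, t) \<in> V \<Longrightarrow> \<exists>s\<in>{0..t}. u (x, s) \<ge> \<beta>" for V
    proof (rule heat[OF V])
      fix z assume zV: "z \<in> V"
      obtain x t where z: "z = (x, t)" by (cases z)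
      have xt: "x \<in> {A<..<B}" "0 < t" "t < T1"
        using zV V(2) by (auto simp: z box_Pair_iff subset_iff)
      have x: "x \<in> Omega" using Omega xt by auto
      obtain s where s: "s \<in> {0..t}" "u (x, s) \<ge> \<beta>" using sw zV z by blast
      have "hyst \<alpha> \<beta> T1 p u (x, t) = -1"
        by (rule hyst_switched[OF assms(8) x _ _ cont_t _ u_init[OF x] s]) (use xt above in auto)
      then show "hyst \<alpha> \<beta> T1 p u z \<le> - 1" by (simp add: z)
    qed
    show "u (x, 0) \<le> \<beta>" if "x \<in> {A..B}" for x
      using phi_le[OF that] u_init Omega that by auto
  qed (rule lateral)
  have r: "?r x \<in> {0..T1}" "u (x, ?r x) \<ge> \<beta>" if "x \<in> {a<..<b}" for x
    using switch_time_attained[OF cont_t assms(18)[OF that]] ab that by auto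
  have contact: "t \<in> {0..T1} \<and> u (x, t) = \<beta>" if "(x, t) \<in> closure ((\<lambda>x. (x, ?r x)) ` {a<..<b})" for x t
  proof -
    let ?S = "{z \<in> cbox (A, 0) (B, T1). u z = \<beta>}"
    have "(\<lambda>x. (x, ?r x)) ` {a<..<b} \<subseteq> ?S"
    proof
      fix z assume "z \<in> (\<lambda>x. (x, ?r x)) ` {a<..<b}"
      then obtain x where x: "x \<in> {a<..<b}" "z = (x, ?r x)" by blast
      then have "z \<in> cbox (A, 0) (B, T1)" using r[OF x(1)] subsetD[OF ab x(1)] by (auto simp: cbox_Pair_iff)
      then show "z \<in> ?S" using r(2)[OF x(1)] u_le[of z] x(2) by auto
    qed
    moreover have "closed ?S"
    proof -
      have "?S = cbox (A, 0) (B, T1) \<inter> u -` {\<beta>}" by auto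
      then show ?thesis using continuous_closed_preimage[OF cont_u closed_cbox closed_singleton] by simp
    qed
    ultimately have "(x, t) \<in> ?S" using that closure_minimal by blast
    then show ?thesis by (auto simp: cbox_Pair_iff)
  qed
  obtain C where C: "\<And>x. x \<in> {a<..<b} \<Longrightarrow> ?r x \<le> C"
    "\<And>x. x \<in> {a<..<b} \<Longrightarrow> (x, C) \<in> closure ((\<lambda>x. (x, ?r x)) ` {a<..<b})"
  proof (rule graph_closure_constant[OF assms(16) r(1)])
    fix x t e m d :: real
    assume x: "x \<in> {a<..<b}" and xt: "(x, t) \<in> closure ((\<lambda>x. (x, ?r x)) ` {a<..<b})"
      and e: "e = 1 \<or> e = -1" and m: "m > 0" and d: "d > 0"
      and le: "\<And>h. 0 < h \<Longrightarrow> h < d \<Longrightarrow> x - e * h \<in> {a<..<b} \<and> ?r (x - e * h) \<le> t - m * h"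
    have "0 \<le> t - m * (d / 2)"
      using le[of "d / 2"] r(1)[of "x - e * (d / 2)"] d by auto
    moreover have "m * (d / 2) > 0" using m d by simp
    ultimately have "t > 0" by linarith
    have "x \<in> {A<..<B}" using ab x by blast
    then have AB: "A < x" "x < B" by auto
    show False
    proof (rule no_oblique_touching[OF AB \<open>t > 0\<close> _ _ e m d])
      show "t \<le> T1" "u (x, t) = \<beta>" using contact[OF xt] by auto
      fix h s assume h: "0 < h" "h < d" and s: "t - m * h < s"
      have "x - e * h \<in> {a<..<b}" "?r (x - e * h) < s" using le[OF h] s by auto
      then show "\<exists>s'\<in>{0..s}. \<beta> \<le> u (x - e * h, s')"
        using r[of "x - e * h"] by (intro bexI[of _ "?r (x - e * h)"]) auto
    qed
  qed auto
  have L: "Limsup (at_left x) (\<lambda>x. ereal (?r x)) = ereal C" "Limsup (at_right x) (\<lambda>x. ereal (?r x)) = ereal C"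
    "Limsup (at x) (\<lambda>x. ereal (?r x)) = ereal C" if "x \<in> {a<..<b}" for x
    using Limsup_graph_closure[of a b ?r C x] C that by blast+
  have lim: "limsup_fun ?r x = C" if "x \<in> {a<..<b}" for x
    using L(3)[OF that] by (simp add: limsup_fun_def)
  have "?r x = C" if "continuous_on {a<..<b} ?r" "x \<in> {a<..<b}" for x
  proof -
    have "isCont ?r x" using that by (simp add: continuous_on_eq_continuous_at)
    then have lim_r: "((\<lambda>x. ereal (?r x)) \<longlongrightarrow> ereal (?r x)) (at x)" by (simp add: isCont_def)
    have "Limsup (at x) (\<lambda>x. ereal (?r x)) = ereal (?r x)"
      by (rule lim_imp_Limsup[OF _ lim_r]) simp
    then show ?thesis using L(3)[OF that(2)] by simp
  qed
  then show ?thesis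
    unfolding constant_on_def using L(1,2) lim contact[OF C(2)] by auto
qed

end
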